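(* Let $1<p<\infty$, let $T\in\mathcal L(\ell_p)$ and let $\lambda\in\mathbb C$. Then $\lambda\in W_e(T)$ if and only if, for every finite-codimensional subspace $M\subset\ell_p$, every finite-dimensional subspace $F\subset\ell_p$, and every $\varepsilon>0$, there are $x\in M$ and $x^*\in F^\perp$ such that $$\|x\|=1,\qquad \langle x,x^*\rangle=1,\qquad \|x^*\|<1+\varepsilon,\qquad |\langle Tx,x^*\rangle-\lambda|<\varepsilon.$$ In the implication from $\lambda\in W_e(T)$ to this condition, $x$ may moreover be chosen with finite support.
   Context: $\ell_p=\ell_p(\mathbb N)$ is the complex sequence space and $\mathcal L(\ell_p)$ its algebra of bounded linear operators. Finite-codimensional subspaces are understood to be closed. With $1/p+1/q=1$, the dual $(\ell_p)^*$ is identified with $\ell_q$ via $\langle x,y\rangle=\sum_j x_j\overline{y_j}$, and $F^\perp=\{x^*\in\ell_q:\ \langle f,x^*\rangle=0\text{ for all }f\in F\}$. For $x=(x_j)\in\ell_p$ put $J(x)=(x_j|x_j|^{p-2})_j\in\ell_q$ (with $0$ in the coordinates where $x_j=0$). The essential numerical range $W_e(T)$ is the set of all $\lambda\in\mathbb C$ for which there is a net (equivalently, a sequence) of unit vectors $x_\alpha\in\ell_p$ with $x_\alpha\to0$ weakly and $\langle Tx_\alpha,J(x_\alpha)\rangle\to\lambda$. *)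

theory Defs
  imports "HOL-Analysis.Analysis" "HOL-Library.Function_Algebras"
begin

section \<open>The space of $p$-summable complex sequences\<close>

text \<open>
  The exponent is a real parameter, so the space is a carrier set of functions
  \<open>nat \<Rightarrow> complex\<close>. Addition is the pointwise one of \<^theory>\<open>HOL-Library.Function_Algebras\<close>. The type
  class topology of \<open>nat \<Rightarrow> complex\<close> is the product topology and is not used.
\<close>

definition cscale :: "complex \<Rightarrow> (nat \<Rightarrow> complex) \<Rightarrow> nat \<Rightarrow> complex" where
  "cscale c x = (\<lambda>j. c * x j)"

interpretation cseq: vector_space cscale
  by standard (simp_all add: cscale_def fun_eq_iff algebra_simps)

definition lp :: "real \<Rightarrow> (nat \<Rightarrow> complex) set" where
  "lp p = {x. summable (\<lambda>j. cmod (x j) powr p)}"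

definition lp_norm :: "real \<Rightarrow> (nat \<Rightarrow> complex) \<Rightarrow> real" where
  "lp_norm p x = (\<Sum>j. cmod (x j) powr p) powr (1 / p)"

definition lp_dist :: "real \<Rightarrow> (nat \<Rightarrow> complex) \<Rightarrow> (nat \<Rightarrow> complex) \<Rightarrow> real" where
  "lp_dist p x y = lp_norm p (x - y)"

lemma powr_convex_comb:
  fixes u v t p :: real
  assumes p: "1 \<le> p" and uv: "0 \<le> u" "0 \<le> v" and t: "0 \<le> t" "t \<le> 1"
  shows "(t * u + (1 - t) * v) powr p \<le> t * u powr p + (1 - t) * v powr p"
proof -
  have *: "(s * w) powr p \<le> s * w powr p" if "0 \<le> s" "s \<le> 1" "0 \<le> w" for s w :: real
  proof -
    have "s powr p \<le> s"
      using powr_mono'[of 1 p s] that p by simp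
    then show ?thesis
      using that by (simp add: powr_mult mult_right_mono)
  qed
  consider "u = 0" | "v = 0" | "0 < u" "0 < v" using uv by linarith
  then show ?thesis
  proof cases
    case 1
    then show ?thesis using *[of "1 - t" v] uv t by simp
  next
    case 2
    then show ?thesis using *[of t u] uv t by simp
  next
    case 3
    then show ?thesis
      using convex_onD[OF powr_convex[OF p], of "1 - t" u v] t by simp
  qed
qed

lemma lp_zero: "0 \<in> lp p"
  by (simp add: lp_def)

lemma lp_norm_nonneg: "0 \<le> lp_norm p x"
  by (simp add: lp_norm_def)

lemma lp_norm_powr:
  assumes "0 < p" and "x \<in> lp p"
  shows "lp_norm p x powr p = (\<Sum>j. cmod (x j) powr p)"
proof -
  have "0 \<le> (\<Sum>j. cmod (x j) powr p)"
    using assms(2) by (intro suminf_nonneg) (auto simp: lp_def)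
  then show ?thesis
    using assms(1) by (simp add: lp_norm_def powr_powr)
qed

lemma lp_norm_eq_0_iff:
  assumes "0 < p" and "x \<in> lp p"
  shows "lp_norm p x = 0 \<longleftrightarrow> x = 0"
proof -
  have "lp_norm p x = 0 \<longleftrightarrow> (\<Sum>j. cmod (x j) powr p) = 0"
    by (simp add: lp_norm_def)
  also have "\<dots> \<longleftrightarrow> (\<forall>j. cmod (x j) powr p = 0)"
    using assms(2) by (intro suminf_eq_zero_iff) (auto simp: lp_def)
  finally show ?thesis
    by (simp add: fun_eq_iff)
qed

lemma lp_minkowski:
  assumes p: "1 \<le> p" and x: "x \<in> lp p" and y: "y \<in> lp p"
  shows lp_add: "x + y \<in> lp p" and lp_norm_triangle: "lp_norm p (x + y) \<le> lp_norm p x + lp_norm p y"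
proof -
  define a where "a = lp_norm p x"
  define b where "b = lp_norm p y"
  have sx: "summable (\<lambda>j. cmod (x j) powr p)" and sy: "summable (\<lambda>j. cmod (y j) powr p)"
    using x y by (auto simp: lp_def)
  have p0: "0 < p" using p by simp
  have "x + y \<in> lp p \<and> lp_norm p (x + y) \<le> a + b"
  proof (cases "a = 0 \<or> b = 0")
    case True
    then have "x = 0 \<or> y = 0"
      using x y p0 by (simp add: a_def b_def lp_norm_eq_0_iff)
    then show ?thesis
      using x y lp_norm_nonneg[of p x] lp_norm_nonneg[of p y] by (auto simp: a_def b_def)
  next
    case False
    then have ab: "0 < a" "0 < b"
      using lp_norm_nonneg[of p x] lp_norm_nonneg[of p y] by (auto simp: a_def b_def)
    define t where "t = a / (a + b)"
    have t: "0 \<le> t" "t \<le> 1" and t': "1 - t = b / (a + b)"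
      using ab by (auto simp: t_def field_simps)
    define g where "g = (\<lambda>j. (a + b) powr p *
      (t * (cmod (x j) powr p / a powr p) + (1 - t) * (cmod (y j) powr p / b powr p)))"
    have le: "cmod ((x + y) j) powr p \<le> g j" for j
    proof -
      let ?c = "t * (cmod (x j) / a) + (1 - t) * (cmod (y j) / b)"
      have c0: "0 \<le> ?c" using t ab by simp
      have "cmod (x j) + cmod (y j) = (a + b) * ?c"
        using ab unfolding t' by (simp add: t_def distrib_left)
      then have "cmod ((x + y) j) powr p \<le> ((a + b) * ?c) powr p"
        using p by (intro powr_mono2) (auto intro: order_trans[OF norm_triangle_ineq])
      also have "\<dots> = (a + b) powr p * ?c powr p"
        using ab c0 by (intro powr_mult)
      also have "\<dots> \<le> (a + b) powr p *
          (t * (cmod (x j) / a) powr p + (1 - t) * (cmod (y j) / b) powr p)"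
        using powr_convex_comb[OF p, of "cmod (x j) / a" "cmod (y j) / b" t] ab t
        by (intro mult_left_mono) auto
      also have "\<dots> = g j"
        using ab by (simp add: g_def powr_divide)
      finally show ?thesis .
    qed
    have g_sums: "g sums ((a + b) powr p)"
    proof -
      have "(\<lambda>j. cmod (x j) powr p) sums (a powr p)" "(\<lambda>j. cmod (y j) powr p) sums (b powr p)"
        using sx sy lp_norm_powr[OF p0 x] lp_norm_powr[OF p0 y]
        by (simp_all add: a_def b_def summable_sums)
      then have "g sums ((a + b) powr p *
          (t * (a powr p / a powr p) + (1 - t) * (b powr p / b powr p)))"
        unfolding g_def by (intro sums_mult sums_add sums_divide)
      then show ?thesis using ab by simp
    qed
    have s: "summable (\<lambda>j. cmod ((x + y) j) powr p)"
      by (rule summable_comparison_test'[OF sums_summable[OF g_sums], where N = 0])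
        (use le in \<open>simp del: plus_fun_apply\<close>)
    have "(\<Sum>j. cmod ((x + y) j) powr p) \<le> (a + b) powr p"
      using suminf_le[OF le s sums_summable[OF g_sums]] g_sums by (simp add: sums_iff)
    moreover have "0 \<le> (\<Sum>j. cmod ((x + y) j) powr p)"
      using s by (intro suminf_nonneg) auto
    ultimately have "lp_norm p (x + y) \<le> ((a + b) powr p) powr (1 / p)"
      unfolding lp_norm_def using p0 by (intro powr_mono2) auto
    also have "\<dots> = a + b" using ab p0 by (simp add: powr_powr)
    finally show ?thesis using s by (simp add: lp_def)
  qed
  then show "x + y \<in> lp p" "lp_norm p (x + y) \<le> lp_norm p x + lp_norm p y"
    by (auto simp: a_def b_def)
qed

lemma lp_scale: "x \<in> lp p \<Longrightarrow> cscale c x \<in> lp p"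
  by (simp add: lp_def cscale_def norm_mult powr_mult summable_mult)

lemma subspace_lp: "1 \<le> p \<Longrightarrow> cseq.subspace (lp p)"
  by (intro cseq.subspaceI lp_zero lp_add lp_scale)

lemma lp_diff: "1 \<le> p \<Longrightarrow> x \<in> lp p \<Longrightarrow> y \<in> lp p \<Longrightarrow> x - y \<in> lp p"
  by (rule cseq.subspace_diff[OF subspace_lp])

lemma Metric_space_lp:
  assumes p: "1 \<le> p"
  shows "Metric_space (lp p) (lp_dist p)"
proof
  fix x y z
  show "0 \<le> lp_dist p x y"
    by (simp add: lp_dist_def lp_norm_nonneg)
  show "lp_dist p x y = lp_dist p y x"
    by (simp add: lp_dist_def lp_norm_def norm_minus_commute)
  assume xy: "x \<in> lp p" "y \<in> lp p"
  show "lp_dist p x y = 0 \<longleftrightarrow> x = y"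
    using lp_norm_eq_0_iff[OF _ lp_diff[OF p xy]] p by (simp add: lp_dist_def)
  assume z: "z \<in> lp p"
  show "lp_dist p x z \<le> lp_dist p x y + lp_dist p y z"
    using lp_norm_triangle[OF p lp_diff[OF p xy] lp_diff[OF p xy(2) z]]
    by (simp add: lp_dist_def)
qed

definition lp_topology :: "real \<Rightarrow> (nat \<Rightarrow> complex) topology" where
  "lp_topology p = Metric_space.mtopology (lp p) (lp_dist p)"

definition bounded_operator :: "real \<Rightarrow> ((nat \<Rightarrow> complex) \<Rightarrow> (nat \<Rightarrow> complex)) \<Rightarrow> bool" where
  "bounded_operator p T \<longleftrightarrow>
     T ` lp p \<subseteq> lp p \<and>
     (\<forall>x\<in>lp p. \<forall>y\<in>lp p. T (x + y) = T x + T y) \<and>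
     (\<forall>c. \<forall>x\<in>lp p. T (cscale c x) = cscale c (T x)) \<and>
     (\<exists>K. \<forall>x\<in>lp p. lp_norm p (T x) \<le> K * lp_norm p x)"

definition finite_dim_subspace :: "real \<Rightarrow> (nat \<Rightarrow> complex) set \<Rightarrow> bool" where
  "finite_dim_subspace p F \<longleftrightarrow> (\<exists>B. finite B \<and> B \<subseteq> lp p \<and> F = cseq.span B)"

definition finite_codim_subspace :: "real \<Rightarrow> (nat \<Rightarrow> complex) set \<Rightarrow> bool" where
  "finite_codim_subspace p M \<longleftrightarrow>
     M \<subseteq> lp p \<and> cseq.subspace M \<and> closedin (lp_topology p) M \<and>
     (\<exists>B. finite B \<and> B \<subseteq> lp p \<and> cseq.span (M \<union> B) = lp p)"


section \<open>Duality and the essential numerical range\<close>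

definition pairing :: "(nat \<Rightarrow> complex) \<Rightarrow> (nat \<Rightarrow> complex) \<Rightarrow> complex" where
  "pairing x y = (\<Sum>j. x j * cnj (y j))"

definition annihilator :: "real \<Rightarrow> (nat \<Rightarrow> complex) set \<Rightarrow> (nat \<Rightarrow> complex) set" where
  "annihilator q F = {y \<in> lp q. \<forall>f\<in>F. pairing f y = 0}"

text \<open>Zero coordinates are mapped to zero, also for \<open>p < 2\<close>, because of the factor \<open>x j\<close>.\<close>

definition duality_map :: "real \<Rightarrow> (nat \<Rightarrow> complex) \<Rightarrow> nat \<Rightarrow> complex" where
  "duality_map p x = (\<lambda>j. x j * of_real (cmod (x j) powr (p - 2)))"

text \<open>
  Here \<open>q\<close> is the exponent conjugate to \<open>p\<close>: the dual of \<open>lp p\<close> is identified with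
  \<open>lp q\<close> through \<^const>\<open>pairing\<close>.
\<close>

definition weakly_null :: "real \<Rightarrow> (nat \<Rightarrow> nat \<Rightarrow> complex) \<Rightarrow> bool" where
  "weakly_null q X \<longleftrightarrow> (\<forall>y\<in>lp q. (\<lambda>n. pairing (X n) y) \<longlonglongrightarrow> 0)"

definition essential_numerical_range ::
    "real \<Rightarrow> real \<Rightarrow> ((nat \<Rightarrow> complex) \<Rightarrow> (nat \<Rightarrow> complex)) \<Rightarrow> complex set" where
  "essential_numerical_range p q T =
     {\<mu>. \<exists>X. (\<forall>n. X n \<in> lp p \<and> lp_norm p (X n) = 1) \<and> weakly_null q X \<and>
           (\<lambda>n. pairing (T (X n)) (duality_map p (X n))) \<longlonglongrightarrow> \<mu>}"

end

theory Submission
  imports Defs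
begin

text \<open>
  Let \<open>J\<close> be the duality map, so that \<open>J x\<close> is the functional of norm one that norms a unit vector \<open>x\<close>.

  A point \<open>\<mu>\<close> of the essential numerical range comes with weakly null unit vectors \<open>X n\<close>. In \<open>\<ell>\<^sub>p\<close>,
  weak convergence of a bounded sequence to zero is convergence to zero in each coordinate, and \<open>J\<close>
  acts coordinatewise, so the functionals \<open>J (X n)\<close> are weakly null as well. A weakly null sequence
  comes arbitrarily close in norm to any closed subspace of finite codimension
  (\<open>weakly_null_near_finite_codim_subspace\<close>). This is applied twice: to \<open>X n\<close> and the subspace \<open>M\<close> of
  \<open>\<ell>\<^sub>p\<close>, and to \<open>J (X n)\<close> and the annihilator of \<open>F\<close>, which has finite codimension in \<open>\<ell>\<^sub>q\<close>. Since the
  corrections are small in norm, the pair obtained satisfies all conditions approximately, and a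
  rescaling turns \<open>\<parallel>x\<parallel> = 1\<close> and \<open>\<langle>x, x\<^sup>*\<rangle> = 1\<close> into equations. The approximation in \<open>M\<close> comes from a
  projection onto \<open>M\<close> along finitely many unit sequences (\<open>finite_codim_projection\<close>), which preserves
  finite supports; truncating \<open>X n\<close> beforehand makes the vectors finitely supported.

  Conversely, apply the condition to the sequences that vanish in the first \<open>n\<close> coordinates and to
  a tolerance that tends to zero. The resulting unit vectors \<open>x\<^sub>n\<close> are weakly null, and the functionals \<open>x\<^sub>n\<^sup>*\<close>
  have norm tending to one and satisfy \<open>\<langle>x\<^sub>n, x\<^sub>n\<^sup>*\<rangle> = 1\<close>. Such functionals approach \<open>J x\<^sub>n\<close> in norm
  (\<open>duality_map_stability\<close>), so \<open>\<langle>T x\<^sub>n, J x\<^sub>n\<rangle>\<close> has the same limit as \<open>\<langle>T x\<^sub>n, x\<^sub>n\<^sup>*\<rangle>\<close>. The reason is a quantitative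
  form of the equality case in the inequality of Young for complex numbers
  (\<open>young_deficit_stability\<close>), summed over the coordinates; it treats all exponents alike.
\<close>

section \<open>Norms, truncations and bounded operators\<close>

definition unit_seq :: "nat \<Rightarrow> nat \<Rightarrow> complex" where
  "unit_seq k = (\<lambda>j. if j = k then 1 else 0)"

definition trunc :: "nat \<Rightarrow> (nat \<Rightarrow> complex) \<Rightarrow> nat \<Rightarrow> complex" where
  "trunc N x = (\<lambda>j. if j < N then x j else 0)"

lemma lp_norm_zero: "lp_norm p 0 = 0"
  by (simp add: lp_norm_def)

lemma lp_norm_scale:
  assumes p: "0 < p" and x: "x \<in> lp p"
  shows "lp_norm p (cscale c x) = cmod c * lp_norm p x"
proof -
  have s: "summable (\<lambda>j. cmod (x j) powr p)" using x by (simp add: lp_def)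
  have "(\<Sum>j. cmod (cscale c x j) powr p) = cmod c powr p * (\<Sum>j. cmod (x j) powr p)"
    using suminf_mult[OF s, of "cmod c powr p"] by (simp add: cscale_def norm_mult powr_mult)
  moreover have "0 \<le> (\<Sum>j. cmod (x j) powr p)" using s by (intro suminf_nonneg) auto
  ultimately show ?thesis using p
    by (simp add: lp_norm_def powr_mult powr_powr)
qed

lemma lp_norm_minus_commute: "lp_norm p (x - y) = lp_norm p (y - x)"
  by (simp add: lp_norm_def norm_minus_commute)

lemma lp_norm_diff_le:
  assumes "1 \<le> p" "x \<in> lp p" "y \<in> lp p"
  shows "\<bar>lp_norm p x - lp_norm p y\<bar> \<le> lp_norm p (x - y)"
proof -
  have "lp_norm p ((x - y) + y) \<le> lp_norm p (x - y) + lp_norm p y"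
    using assms by (intro lp_norm_triangle lp_diff)
  moreover have "lp_norm p ((y - x) + x) \<le> lp_norm p (y - x) + lp_norm p x"
    using assms by (intro lp_norm_triangle lp_diff)
  ultimately show ?thesis
    by (simp add: lp_norm_minus_commute[of p y x])
qed

lemma lp_norm_sum_le:
  assumes p: "1 \<le> p" and "\<And>i. i \<in> A \<Longrightarrow> f i \<in> lp p"
  shows "lp_norm p (\<Sum>i\<in>A. f i) \<le> (\<Sum>i\<in>A. lp_norm p (f i))"
  using assms(2)
proof (induction A rule: infinite_finite_induct)
  case (insert a A)
  have "lp_norm p (f a + (\<Sum>i\<in>A. f i)) \<le> lp_norm p (f a) + lp_norm p (\<Sum>i\<in>A. f i)"
    using insert.prems by (intro lp_norm_triangle p cseq.subspace_sum[OF subspace_lp[OF p]]) auto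
  also have "\<dots> \<le> lp_norm p (f a) + (\<Sum>i\<in>A. lp_norm p (f i))"
    using insert by simp
  finally show ?case unfolding sum.insert[OF insert.hyps] .
qed (simp_all add: lp_norm_def)

lemma finite_support_in_lp: "finite {j. x j \<noteq> 0} \<Longrightarrow> x \<in> lp p"
  unfolding lp_def by (auto intro!: summable_finite[of "{j. x j \<noteq> 0}"])

lemma trunc_in_lp: "trunc N x \<in> lp p"
  by (rule finite_support_in_lp) (rule finite_subset[of _ "{..<N}"], auto simp: trunc_def)

lemma unit_seq_in_lp: "unit_seq k \<in> lp p"
  by (rule finite_support_in_lp) (rule finite_subset[of _ "{k}"], auto simp: unit_seq_def)

lemma sum_fun_apply: "(\<Sum>i\<in>A. f i) x = (\<Sum>i\<in>A. f i x)"
  for f :: "'a \<Rightarrow> 'b \<Rightarrow> complex"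
  by (induction A rule: infinite_finite_induct) auto

lemma trunc_eq_sum: "trunc N x = (\<Sum>k<N. cscale (x k) (unit_seq k))"
  by (auto simp: fun_eq_iff sum_fun_apply trunc_def cscale_def unit_seq_def if_distrib
      sum.delta cong: if_cong)

lemma lp_norm_tail_tendsto_0:
  assumes p: "0 < p" and x: "x \<in> lp p"
  shows "(\<lambda>N. lp_norm p (x - trunc N x)) \<longlonglongrightarrow> 0"
proof -
  define f where "f = (\<lambda>j. cmod (x j) powr p)"
  have f: "summable f" using x by (simp add: lp_def f_def)
  have tail: "(\<Sum>j. cmod ((x - trunc N x) j) powr p) = suminf f - sum f {..<N}" for N
  proof -
    have "(\<lambda>j. if j \<in> {..<N} then f j else 0) sums sum f {..<N}"
      by (intro sums_If_finite_set) auto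
    from sums_diff[OF summable_sums[OF f] this]
    have "(\<lambda>j. f j - (if j \<in> {..<N} then f j else 0)) sums (suminf f - sum f {..<N})" .
    moreover have "(\<lambda>j. f j - (if j \<in> {..<N} then f j else 0)) = (\<lambda>j. cmod ((x - trunc N x) j) powr p)"
      using p by (auto simp: fun_eq_iff f_def trunc_def)
    ultimately show ?thesis by (simp add: sums_iff)
  qed
  have "(\<lambda>N. suminf f - sum f {..<N}) \<longlonglongrightarrow> suminf f - suminf f"
    by (intro tendsto_diff tendsto_const summable_LIMSEQ f)
  moreover have "0 \<le> suminf f - sum f {..<N}" for N
    using sum_le_suminf[OF f, of "{..<N}"] by (auto simp: f_def)
  ultimately have "(\<lambda>N. (suminf f - sum f {..<N}) powr (1/p)) \<longlonglongrightarrow> 0 powr (1/p)"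
    using p by (intro tendsto_powr' tendsto_const) (auto intro: always_eventually)
  then show ?thesis unfolding lp_norm_def tail by simp
qed

lemma pairing_unit_seq_right: "pairing x (unit_seq k) = x k"
proof -
  have "pairing x (unit_seq k) = (\<Sum>j\<in>{k}. x j * cnj (unit_seq k j))"
    unfolding pairing_def by (rule suminf_finite) (auto simp: unit_seq_def)
  then show ?thesis by (simp add: unit_seq_def)
qed

text \<open>
  The scalar function that \<^const>\<open>duality_map\<close> applies to each coordinate. For nonzero \<open>a\<close> it is
  the point \<open>b\<close> at which equality holds in Young's inequality for \<open>a\<close> and \<open>b\<close>.
\<close>

definition dual_point :: "real \<Rightarrow> complex \<Rightarrow> complex" where
  "dual_point p a = a * of_real (cmod a powr (p - 2))"

lemma norm_dual_point: "cmod (dual_point p a) = cmod a powr (p - 1)"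
proof (cases "a = 0")
  case False
  have "cmod a powr (p - 1) = cmod a powr 1 * cmod a powr (p - 2)"
    unfolding powr_add[symmetric] by simp
  then show ?thesis using False by (simp add: dual_point_def norm_mult)
qed (simp add: dual_point_def)

lemma duality_map_eq_dual_point: "duality_map p x j = dual_point p (x j)"
  by (simp add: duality_map_def dual_point_def)

lemma duality_map_norm: "cmod (duality_map p x j) = cmod (x j) powr (p - 1)"
  by (simp add: duality_map_eq_dual_point norm_dual_point)

lemma continuous_dual_point:
  assumes "1 < p"
  shows "continuous_on UNIV (dual_point p)"
proof -
  have "isCont (dual_point p) a" for a
  proof (cases "a = 0")
    case True
    have "((\<lambda>z. cmod z powr (p - 1)) \<longlongrightarrow> cmod 0 powr (p - 1)) (at 0)"
      using assms by (intro tendsto_powr' tendsto_norm tendsto_ident_at tendsto_const)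
        (auto intro: always_eventually)
    then have "(dual_point p \<longlongrightarrow> 0) (at 0)"
      by (intro tendsto_norm_zero_cancel[of "dual_point p"]) (simp add: norm_dual_point)
    then show ?thesis by (simp add: True isCont_def dual_point_def)
  next
    case False
    then show ?thesis unfolding dual_point_def by (intro continuous_intros) auto
  qed
  then show ?thesis by (simp add: continuous_at_imp_continuous_on)
qed

lemma bounded_operator_in_lp: "bounded_operator p T \<Longrightarrow> x \<in> lp p \<Longrightarrow> T x \<in> lp p"
  unfolding bounded_operator_def by blast

lemma bounded_operatorE:
  assumes "bounded_operator p T"
  obtains K where "0 \<le> K" "\<And>x. x \<in> lp p \<Longrightarrow> lp_norm p (T x) \<le> K * lp_norm p x"
proof -
  obtain K where K: "\<And>x. x \<in> lp p \<Longrightarrow> lp_norm p (T x) \<le> K * lp_norm p x"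
    using assms unfolding bounded_operator_def by blast
  have "lp_norm p (T x) \<le> max K 0 * lp_norm p x" if "x \<in> lp p" for x
    using K[OF that] lp_norm_nonneg[of p x] by (meson max.cobounded1 mult_right_mono order_trans)
  then show ?thesis using that[of "max K 0"] by simp
qed

lemma bounded_operator_diff:
  assumes T: "bounded_operator p T" and xy: "x \<in> lp p" "y \<in> lp p"
  shows "T (x - y) = T x - T y"
proof -
  have minus: "u + cscale (- 1) v = u - v" for u v
    by (simp add: fun_eq_iff cscale_def)
  have "T (x + cscale (- 1) y) = T x + T (cscale (- 1) y)"
    using T xy lp_scale[OF xy(2), of "- 1"] unfolding bounded_operator_def by blast
  also have "T (cscale (- 1) y) = cscale (- 1) (T y)"
    using T xy unfolding bounded_operator_def by blast
  finally show ?thesis unfolding minus .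
qed

section \<open>Closed subspaces and finite-dimensional extensions\<close>

lemma closedin_lp_iff:
  assumes p: "1 \<le> p"
  shows "closedin (lp_topology p) M \<longleftrightarrow>
    M \<subseteq> lp p \<and> (\<forall>x\<in>lp p. (\<forall>e>0. \<exists>m\<in>M. lp_norm p (x - m) < e) \<longrightarrow> x \<in> M)"
proof -
  interpret Metric_space "lp p" "lp_dist p" by (rule Metric_space_lp[OF p])
  show ?thesis
    unfolding lp_topology_def closedin_metric disjnt_iff in_mball lp_dist_def
    by (meson DiffD1 DiffD2 DiffI in_mono not_less)
qed

lemma distance_pos:
  assumes "1 \<le> p" "closedin (lp_topology p) M" "x \<in> lp p" "x \<notin> M"
  obtains d where "0 < d" "\<And>m. m \<in> M \<Longrightarrow> d \<le> lp_norm p (x - m)"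
  using assms by (meson closedin_lp_iff not_less)

text \<open>
  Rescaling \<open>w = m + t b\<close> by \<open>1 / t\<close> gives \<open>b\<close> minus an element of \<open>M\<close>, which has norm at
  least \<open>d\<close>. So the coefficient of \<open>b\<close> in the sum of \<open>M\<close> and the line through \<open>b\<close> is a bounded
  functional. Both the closedness of this sum and the functionals separating a closed hyperplane
  come from this bound.
\<close>

lemma coefficient_bound:
  assumes p: "1 \<le> p" and M: "cseq.subspace M" "M \<subseteq> lp p" and b: "b \<in> lp p"
    and d: "0 < d" "\<And>m. m \<in> M \<Longrightarrow> d \<le> lp_norm p (b - m)"
    and w: "w - cscale t b \<in> M"
  shows "cmod t * d \<le> lp_norm p w"
proof (cases "t = 0")
  case True
  then show ?thesis by (simp add: lp_norm_nonneg)
next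
  case False
  define m where "m = w - cscale t b"
  have m: "m \<in> M" "m \<in> lp p" using w M by (auto simp: m_def)
  have "d \<le> lp_norm p (b - cscale (- 1 / t) m)"
    using M(1) m(1) by (intro d(2)) (rule cseq.subspace_scale)
  then have "cmod t * d \<le> cmod t * lp_norm p (b - cscale (- 1 / t) m)"
    by (rule mult_left_mono) simp
  also have "\<dots> = lp_norm p (cscale t (b - cscale (- 1 / t) m))"
    using p m b by (intro lp_norm_scale[symmetric] lp_diff lp_scale) auto
  also have "cscale t (b - cscale (- 1 / t) m) = w"
    using False by (auto simp: m_def cscale_def fun_eq_iff field_simps)
  finally show ?thesis .
qed

lemma span_span_Un: "cseq.span (cseq.span A \<union> B) = cseq.span (A \<union> B)"
  by (simp only: cseq.span_Un cseq.span_span)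

lemma span_subset_lp: "1 \<le> p \<Longrightarrow> S \<subseteq> lp p \<Longrightarrow> cseq.span S \<subseteq> lp p"
  by (simp add: cseq.span_minimal subspace_lp)

text \<open>
  Along an approximating sequence \<open>m\<^sub>n + t\<^sub>n b\<close> the coefficients \<open>t\<^sub>n\<close> form a Cauchy sequence of scalars,
  by the coefficient bound. Once they converge to \<open>t\<close>, the vectors \<open>m\<^sub>n\<close> approximate \<open>z - t b\<close>,
  which lies in \<open>M\<close> because \<open>M\<close> is closed.
\<close>

lemma closed_span_insert:
  assumes p: "1 \<le> p" and M: "cseq.subspace M" "closedin (lp_topology p) M" and b: "b \<in> lp p"
  shows "closedin (lp_topology p) (cseq.span (insert b M))"
proof (cases "b \<in> M")
  case True
  then show ?thesis using M by (simp add: insert_absorb cseq.span_eq_iff[THEN iffD2, OF M(1)])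
next
  case False
  have sub: "M \<subseteq> lp p" using M(2) closedin_lp_iff[OF p] by blast
  obtain d where d: "0 < d" "\<And>m. m \<in> M \<Longrightarrow> d \<le> lp_norm p (b - m)"
    using distance_pos[OF p M(2) b False] by blast
  have span: "w \<in> cseq.span (insert b M) \<longleftrightarrow> (\<exists>t. w - cscale t b \<in> M)" for w
    by (simp add: cseq.span_breakdown_eq cseq.span_eq_iff[THEN iffD2, OF M(1)])
  show ?thesis
    unfolding closedin_lp_iff[OF p]
  proof (intro conjI ballI impI)
    show "cseq.span (insert b M) \<subseteq> lp p"
      using sub b by (intro span_subset_lp p) auto
    fix z assume z: "z \<in> lp p" and approx: "\<forall>e>0. \<exists>w\<in>cseq.span (insert b M). lp_norm p (z - w) < e"
    have "\<exists>t w. w - cscale t b \<in> M \<and> lp_norm p (z - w) < 1 / Suc n" for n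
      using approx[rule_format, of "1 / Suc n"] unfolding span Bex_def by (simp; blast)
    then obtain t w where tw: "\<And>n. w n - cscale (t n) b \<in> M"
      "\<And>n. lp_norm p (z - w n) < 1 / Suc n" by metis
    have w: "w n \<in> lp p" for n
      using lp_add[OF p subsetD[OF sub tw(1)] lp_scale[OF b]] by (metis diff_add_cancel)
    have close: "cmod (t n - t k) * d \<le> 1 / Suc n + 1 / Suc k" for n k
    proof -
      have "(w n - cscale (t n) b) - (w k - cscale (t k) b) \<in> M"
        by (intro cseq.subspace_diff M tw)
      also have "(w n - cscale (t n) b) - (w k - cscale (t k) b) = (w n - w k) - cscale (t n - t k) b"
        by (auto simp: fun_eq_iff cscale_def algebra_simps)
      finally have "cmod (t n - t k) * d \<le> lp_norm p (w n - w k)"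
        by (intro coefficient_bound[OF p M(1) sub b d])
      also have "w n - w k = (z - w k) + (w n - z)" by simp
      also have "lp_norm p \<dots> \<le> lp_norm p (z - w k) + lp_norm p (w n - z)"
        by (intro lp_norm_triangle lp_diff p z w)
      also have "\<dots> \<le> 1 / Suc n + 1 / Suc k"
        using tw(2)[of n] tw(2)[of k] by (simp add: lp_norm_minus_commute[of p "w n"])
      finally show ?thesis .
    qed
    have "Cauchy t"
    proof (rule metric_CauchyI)
      fix e :: real assume e: "0 < e"
      obtain N where N: "1 / Suc N < d * e / 2"
        using nat_approx_posE[of "d * e / 2"] d e by auto
      have "dist (t n) (t k) < e" if "n \<ge> N" "k \<ge> N" for n k
      proof -
        have "1 / Suc n \<le> 1 / Suc N" "1 / Suc k \<le> 1 / Suc N"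
          using that by (auto intro!: divide_left_mono)
        then have "cmod (t n - t k) * d < e * d"
          using close[of n k] N by (simp add: mult.commute)
        then show ?thesis using d by (simp add: dist_norm)
      qed
      then show "\<exists>N. \<forall>n\<ge>N. \<forall>k\<ge>N. dist (t n) (t k) < e" by blast
    qed
    then have "convergent t" by (rule Cauchy_convergent)
    then obtain t0 where t0: "t \<longlonglongrightarrow> t0" unfolding convergent_def by blast
    have lim: "(\<lambda>n. 1 / Suc n + cmod (t n - t0) * lp_norm p b) \<longlonglongrightarrow> 0 + 0 * lp_norm p b"
      using t0 by (intro tendsto_intros LIMSEQ_Suc[OF lim_1_over_n] tendsto_norm_zero)
        (simp add: LIM_zero_iff)
    have "z - cscale t0 b \<in> M"
    proof -
      have "\<exists>m\<in>M. lp_norm p (z - cscale t0 b - m) < e" if "0 < e" for e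
      proof -
        from order_tendstoD(2)[OF lim, of e] that obtain n where
          n: "1 / Suc n + cmod (t n - t0) * lp_norm p b < e"
          by (auto simp: eventually_sequentially)
        have eq: "z - cscale t0 b - (w n - cscale (t n) b) = (z - w n) + cscale (t n - t0) b"
          by (auto simp: fun_eq_iff cscale_def algebra_simps)
        have "lp_norm p (z - cscale t0 b - (w n - cscale (t n) b)) \<le>
            lp_norm p (z - w n) + cmod (t n - t0) * lp_norm p b"
          unfolding eq using lp_norm_triangle[OF p, of "z - w n" "cscale (t n - t0) b"] p z w b
          by (simp add: lp_norm_scale lp_diff lp_scale)
        also have "\<dots> < e" using n tw(2)[of n] by simp
        finally show ?thesis using tw(1) by blast
      qed
      then show ?thesis
        using M(2) z b p unfolding closedin_lp_iff[OF p] by (simp add: lp_diff lp_scale)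
    qed
    then show "z \<in> cseq.span (insert b M)" unfolding span by blast
  qed
qed

lemma closed_span_Un_finite:
  assumes p: "1 \<le> p" and "finite B" "B \<subseteq> lp p" and M: "cseq.subspace M" "closedin (lp_topology p) M"
  shows "closedin (lp_topology p) (cseq.span (M \<union> B))"
  using assms(2,3)
proof (induction B)
  case empty
  then show ?case using M by (simp add: cseq.span_eq_iff[THEN iffD2, OF M(1)])
next
  case (insert b B)
  have "cseq.span (insert b (cseq.span (M \<union> B))) = cseq.span (M \<union> insert b B)"
    by (simp add: cseq.span_insert cseq.span_span)
  then show ?case
    using closed_span_insert[OF p cseq.subspace_span, of "M \<union> B" b] insert by simp
qed

lemma lp_subset_closed_subspace:
  assumes p: "1 \<le> p" and W: "cseq.subspace W" "closedin (lp_topology p) W" "range unit_seq \<subseteq> W"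
  shows "lp p \<subseteq> W"
proof
  fix x assume x: "x \<in> lp p"
  have "trunc N x \<in> W" for N
    unfolding trunc_eq_sum using W by (intro cseq.subspace_sum cseq.subspace_scale) auto
  moreover have "\<exists>N. lp_norm p (x - trunc N x) < e" if "0 < e" for e
    using order_tendstoD(2)[OF lp_norm_tail_tendsto_0 that, of p x] p x
    by (auto simp: eventually_sequentially)
  ultimately show "x \<in> W"
    using W(2) x unfolding closedin_lp_iff[OF p] by blast
qed

text \<open>
  A complement of \<open>M\<close> can be chosen among the unit sequences: as long as \<open>M\<close> together with the
  unit sequences found so far does not span everything, its span is closed and proper, hence misses
  some unit sequence, and this one can be exchanged for a vector of the given complement. With such
  a complement, the projection onto \<open>M\<close> changes only finitely many coordinates.
\<close>

lemma unit_seq_complement: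
  assumes p: "1 \<le> p" and B: "finite B" "B \<subseteq> lp p"
    and M: "cseq.subspace M" "closedin (lp_topology p) M" and spans: "cseq.span (M \<union> B) = lp p"
  shows "\<exists>C. finite C \<and> C \<subseteq> range unit_seq \<and> cseq.span (M \<union> C) = lp p"
  using B M spans
proof (induction B arbitrary: M)
  case empty
  then show ?case by (intro exI[of _ "{}"]) auto
next
  case (insert b B)
  define M' where "M' = cseq.span (insert b M)"
  have "cseq.span (M' \<union> B) = cseq.span (insert b M \<union> B)"
    unfolding M'_def by (rule span_span_Un)
  then have "cseq.span (M' \<union> B) = lp p" using insert.prems by simp
  moreover have "closedin (lp_topology p) M'"
    unfolding M'_def using insert.prems by (intro closed_span_insert p) auto
  ultimately obtain C where C: "finite C" "C \<subseteq> range unit_seq" "cseq.span (M' \<union> C) = lp p"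
    using insert.IH[of M'] insert.prems by (auto simp: M'_def)
  define W where "W = cseq.span (M \<union> C)"
  have "cseq.span (insert b (M \<union> C)) = cseq.span (M' \<union> C)"
    unfolding M'_def Un_insert_left[symmetric] by (rule span_span_Un[symmetric])
  with C have W: "cseq.span (insert b (M \<union> C)) = lp p" by simp
  have Clp: "C \<subseteq> lp p" using C unit_seq_in_lp by auto
  have closed: "closedin (lp_topology p) W"
    unfolding W_def using insert.prems C Clp by (intro closed_span_Un_finite p) auto
  have Wsub: "W \<subseteq> lp p" using closed closedin_lp_iff[OF p] by blast
  show ?case
  proof (cases "range unit_seq \<subseteq> W")
    case True
    then have "lp p \<subseteq> W"
      using closed unfolding W_def by (intro lp_subset_closed_subspace p) auto
    with Wsub C show ?thesis unfolding W_def by blast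
  next
    case False
    then obtain e where e: "e \<in> range unit_seq" "e \<notin> W" by blast
    have "e \<in> cseq.span (insert b (M \<union> C))" unfolding W using e unit_seq_in_lp by auto
    then have "b \<in> cseq.span (insert e (M \<union> C))"
      using e(2) unfolding W_def by (rule cseq.in_span_insert)
    then have "cseq.span (insert b (insert e (M \<union> C))) = cseq.span (insert e (M \<union> C))"
      by (rule cseq.span_redundant)
    moreover have "lp p \<subseteq> cseq.span (insert b (insert e (M \<union> C)))"
      unfolding W[symmetric] by (intro cseq.span_mono) auto
    moreover have "cseq.span (insert e (M \<union> C)) \<subseteq> lp p"
      using Wsub e unit_seq_in_lp cseq.span_superset[of "M \<union> C"]
      by (intro span_subset_lp p) (auto simp: W_def)
    ultimately have "cseq.span (M \<union> insert e C) = lp p" by simp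
    with C e show ?thesis by (intro exI[of _ "insert e C"]) auto
  qed
qed

section \<open>The pairing of conjugate sequence spaces\<close>

text \<open>
  The two exponents enter symmetrically. Results about \<open>\<ell>\<^sub>p\<close> below are transferred
  to \<open>\<ell>\<^sub>q\<close> by instantiating the locale with the exponents exchanged.
\<close>

locale conjugate_exponents =
  fixes p q :: real
  assumes p_gt_1: "1 < p" and conjugate: "1 / p + 1 / q = 1"
begin

lemma q_gt_1: "1 < q"
proof -
  have 1: "1 / q = 1 - 1 / p" using conjugate by simp
  have "0 < 1 / q" "1 / q < 1" unfolding 1 using p_gt_1 by auto
  then show ?thesis by (simp add: divide_less_eq split: if_splits)
qed

lemma dual: "conjugate_exponents q p"
  using q_gt_1 conjugate by unfold_locales auto

lemma exponent_identities: "(p - 1) * q = p" "p / q = p - 1"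
proof -
  show *: "(p - 1) * q = p"
    using conjugate p_gt_1 q_gt_1 by (simp add: field_simps)
  show "p / q = p - 1" using q_gt_1 by (subst *[symmetric]) simp
qed

text \<open>
  Young's inequality for the normalised sequences, summed over the coordinates.
\<close>

lemma holder:
  assumes x: "x \<in> lp p" and y: "y \<in> lp q"
  shows summable_holder: "summable (\<lambda>j. cmod (x j) * cmod (y j))"
    and suminf_holder: "(\<Sum>j. cmod (x j) * cmod (y j)) \<le> lp_norm p x * lp_norm q y"
proof -
  define a where "a = lp_norm p x"
  define b where "b = lp_norm q y"
  have "summable (\<lambda>j. cmod (x j) * cmod (y j)) \<and> (\<Sum>j. cmod (x j) * cmod (y j)) \<le> a * b"
  proof (cases "a = 0 \<or> b = 0")
    case True
    then have "x = 0 \<or> y = 0"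
      using x y p_gt_1 q_gt_1 by (simp add: a_def b_def lp_norm_eq_0_iff)
    then show ?thesis by (auto simp: a_def b_def lp_norm_nonneg)
  next
    case False
    then have ab: "0 < a" "0 < b"
      using lp_norm_nonneg[of p x] lp_norm_nonneg[of q y] by (auto simp: a_def b_def)
    define g where "g = (\<lambda>j. a * b * (cmod (x j) powr p / a powr p / p + cmod (y j) powr q / b powr q / q))"
    have le: "cmod (x j) * cmod (y j) \<le> g j" for j
    proof -
      have "(cmod (x j) / a) * (cmod (y j) / b) \<le>
          (cmod (x j) / a) powr p / p + (cmod (y j) / b) powr q / q"
        using p_gt_1 q_gt_1 conjugate ab by (intro Youngs_inequality) auto
      also have "\<dots> = cmod (x j) powr p / a powr p / p + cmod (y j) powr q / b powr q / q"
        using ab by (simp add: powr_divide)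
      finally have "a * b * ((cmod (x j) / a) * (cmod (y j) / b)) \<le> g j"
        unfolding g_def using ab by (intro mult_left_mono) auto
      then show ?thesis using ab by simp
    qed
    have g: "g sums (a * b)"
    proof -
      have "(\<lambda>j. cmod (x j) powr p) sums (a powr p)" "(\<lambda>j. cmod (y j) powr q) sums (b powr q)"
        using x y p_gt_1 q_gt_1 lp_norm_powr[of p x] lp_norm_powr[of q y]
        by (simp_all add: a_def b_def summable_sums lp_def)
      then have "g sums (a * b * (a powr p / a powr p / p + b powr q / b powr q / q))"
        unfolding g_def by (intro sums_mult sums_add sums_divide)
      then show ?thesis using ab conjugate by simp
    qed
    have s: "summable (\<lambda>j. cmod (x j) * cmod (y j))"
      by (rule summable_comparison_test'[OF sums_summable[OF g], where N = 0]) (use le in simp)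
    then show ?thesis
      using suminf_le[OF le s sums_summable[OF g]] g by (simp add: sums_iff)
  qed
  then show "summable (\<lambda>j. cmod (x j) * cmod (y j))"
    "(\<Sum>j. cmod (x j) * cmod (y j)) \<le> lp_norm p x * lp_norm q y"
    by (auto simp: a_def b_def)
qed

lemma summable_pairing:
  assumes "x \<in> lp p" and "y \<in> lp q"
  shows "summable (\<lambda>j. x j * cnj (y j))"
  by (rule summable_norm_cancel) (use summable_holder[OF assms] in \<open>simp add: norm_mult\<close>)

lemma norm_pairing_le:
  assumes "x \<in> lp p" and "y \<in> lp q"
  shows "cmod (pairing x y) \<le> lp_norm p x * lp_norm q y"
proof -
  have "cmod (pairing x y) \<le> (\<Sum>j. cmod (x j * cnj (y j)))"
    unfolding pairing_def by (rule summable_norm) (use summable_holder[OF assms] in \<open>simp add: norm_mult\<close>)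
  with suminf_holder[OF assms] show ?thesis by (simp add: norm_mult)
qed

lemma pairing_add_left:
  assumes "x \<in> lp p" "x' \<in> lp p" "y \<in> lp q"
  shows "pairing (x + x') y = pairing x y + pairing x' y"
  unfolding pairing_def
  using suminf_add[OF summable_pairing[OF assms(1,3)] summable_pairing[OF assms(2,3)]]
  by (simp add: distrib_right)

lemma pairing_diff_left:
  assumes "x \<in> lp p" "x' \<in> lp p" "y \<in> lp q"
  shows "pairing (x - x') y = pairing x y - pairing x' y"
  unfolding pairing_def
  using suminf_diff[OF summable_pairing[OF assms(1,3)] summable_pairing[OF assms(2,3)]]
  by (simp add: left_diff_distrib)

lemma pairing_scale_left:
  assumes "x \<in> lp p" "y \<in> lp q"
  shows "pairing (cscale c x) y = c * pairing x y"
  unfolding pairing_def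
  using suminf_mult[OF summable_pairing[OF assms], of c] by (simp add: cscale_def mult.assoc)

lemma pairing_commute:
  assumes "x \<in> lp p" "y \<in> lp q"
  shows "pairing y x = cnj (pairing x y)"
proof -
  have "(\<lambda>j. cnj (x j * cnj (y j))) sums cnj (pairing x y)"
    unfolding pairing_def sums_cnj using summable_pairing[OF assms] by (rule summable_sums)
  then show ?thesis unfolding pairing_def by (simp add: sums_iff mult.commute)
qed

lemma pairing_diff_right:
  assumes "x \<in> lp p" "y \<in> lp q" "y' \<in> lp q"
  shows "pairing x (y - y') = pairing x y - pairing x y'"
  using assms conjugate_exponents.pairing_diff_left[OF dual, of y y' x]
    lp_diff[of q y y'] q_gt_1
  by (simp add: conjugate_exponents.pairing_commute[OF dual, of _ x])

lemma pairing_scale_right: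
  assumes "x \<in> lp p" "y \<in> lp q"
  shows "pairing x (cscale c y) = cnj c * pairing x y"
  using assms conjugate_exponents.pairing_scale_left[OF dual, of y x c] lp_scale[of y q c]
  by (simp add: conjugate_exponents.pairing_commute[OF dual, of _ x])

lemma pairing_difference_tendsto_0:
  assumes A: "\<And>n. A n \<in> lp p" "\<And>n. A' n \<in> lp p" and B: "\<And>n. B n \<in> lp q" "\<And>n. B' n \<in> lp q"
    and bd: "\<And>n. lp_norm p (A' n) \<le> K" "\<And>n. lp_norm q (B' n) \<le> K"
    and limA: "(\<lambda>n. lp_norm p (A n - A' n)) \<longlonglongrightarrow> 0"
    and limB: "(\<lambda>n. lp_norm q (B n - B' n)) \<longlonglongrightarrow> 0"
  shows "(\<lambda>n. pairing (A n) (B n) - pairing (A' n) (B' n)) \<longlonglongrightarrow> 0"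
proof (rule Lim_null_comparison)
  let ?a = "\<lambda>n. lp_norm p (A n - A' n)" and ?b = "\<lambda>n. lp_norm q (B n - B' n)"
  have "(\<lambda>n. ?a n * (K + ?b n) + K * ?b n) \<longlonglongrightarrow> 0 * (K + 0) + K * 0"
    by (intro tendsto_intros limA limB)
  then show "(\<lambda>n. ?a n * (K + ?b n) + K * ?b n) \<longlonglongrightarrow> 0" by simp
  have "cmod (pairing (A n) (B n) - pairing (A' n) (B' n)) \<le> ?a n * (K + ?b n) + K * ?b n" for n
  proof -
    have dA: "A n - A' n \<in> lp p" and dB: "B n - B' n \<in> lp q"
      using A B p_gt_1 q_gt_1 by (auto intro!: lp_diff)
    have eq: "pairing (A n) (B n) - pairing (A' n) (B' n) =
        pairing (A n - A' n) (B n) + pairing (A' n) (B n - B' n)"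
      using A B by (simp add: pairing_diff_left pairing_diff_right)
    have "cmod (pairing (A n) (B n) - pairing (A' n) (B' n)) \<le>
        ?a n * lp_norm q (B n) + lp_norm p (A' n) * ?b n"
      unfolding eq
      by (rule order_trans[OF norm_triangle_ineq
            add_mono[OF norm_pairing_le[OF dA B(1)] norm_pairing_le[OF A(2) dB]]])
    also have "\<dots> \<le> ?a n * (K + ?b n) + K * ?b n"
    proof (intro add_mono mult_left_mono mult_right_mono lp_norm_nonneg bd(1))
      show "lp_norm q (B n) \<le> K + ?b n"
        using lp_norm_diff_le[of q "B n" "B' n"] B q_gt_1 bd(2)[of n] by simp
    qed
    finally show ?thesis .
  qed
  then show "\<forall>\<^sub>F n in sequentially. cmod (pairing (A n) (B n) - pairing (A' n) (B' n)) \<le> ?a n * (K + ?b n) + K * ?b n"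
    by simp
qed

text \<open>
  A fixed \<open>y\<close> in \<open>\<ell>\<^sub>q\<close> is a finitely supported sequence plus a tail of small norm. The first part
  sees finitely many coordinates of \<open>X n\<close>, and Hoelder's inequality bounds the contribution of the
  tail uniformly in \<open>n\<close>.
\<close>

lemma weakly_null_of_bounded_coordinatewise:
  assumes X: "\<And>n. X n \<in> lp p" and K: "\<And>n. lp_norm p (X n) \<le> K"
    and lim: "\<And>j. (\<lambda>n. X n j) \<longlonglongrightarrow> 0"
  shows "weakly_null q X"
  unfolding weakly_null_def
proof
  fix y assume y: "y \<in> lp q"
  have K0: "0 \<le> K" using K[of 0] lp_norm_nonneg[of p "X 0"] by linarith
  have head: "(\<lambda>n. pairing (X n) (trunc N y)) \<longlonglongrightarrow> 0" for N
  proof -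
    have "pairing (X n) (trunc N y) = (\<Sum>j<N. X n j * cnj (y j))" for n
      unfolding pairing_def by (subst suminf_finite[of "{..<N}"]) (auto simp: trunc_def)
    moreover have "(\<lambda>n. \<Sum>j<N. X n j * cnj (y j)) \<longlonglongrightarrow> (\<Sum>j<N. 0 * cnj (y j))"
      by (intro tendsto_intros lim)
    ultimately show ?thesis by simp
  qed
  show "(\<lambda>n. pairing (X n) y) \<longlonglongrightarrow> 0"
  proof (rule LIMSEQ_I)
    fix e :: real assume e: "0 < e"
    have "(\<lambda>N. K * lp_norm q (y - trunc N y)) \<longlonglongrightarrow> K * 0"
      using y q_gt_1 by (intro tendsto_intros lp_norm_tail_tendsto_0) auto
    from order_tendstoD(2)[OF this, of "e/2"] e
    have "eventually (\<lambda>N. K * lp_norm q (y - trunc N y) < e/2) sequentially" by simp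
    then obtain N where N: "K * lp_norm q (y - trunc N y) < e/2"
      by (auto simp: eventually_sequentially)
    from LIMSEQ_D[OF head[of N], of "e/2"] e obtain n0 where
      n0: "\<And>n. n \<ge> n0 \<Longrightarrow> cmod (pairing (X n) (trunc N y)) < e/2" by auto
    have "cmod (pairing (X n) y) < e" if "n \<ge> n0" for n
    proof -
      have d: "y - trunc N y \<in> lp q" using y q_gt_1 by (intro lp_diff trunc_in_lp) auto
      have eq: "pairing (X n) y = pairing (X n) (trunc N y) + pairing (X n) (y - trunc N y)"
        using X y by (simp add: pairing_diff_right trunc_in_lp)
      have "cmod (pairing (X n) (y - trunc N y)) \<le> K * lp_norm q (y - trunc N y)"
        using norm_pairing_le[OF X d, of n] K[of n] lp_norm_nonneg
        by (meson mult_right_mono order_trans)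
      then show ?thesis
        unfolding eq using n0[OF that] N norm_triangle_ineq[of "pairing (X n) (trunc N y)" "pairing (X n) (y - trunc N y)"]
        by linarith
    qed
    then show "\<exists>no. \<forall>n\<ge>no. cmod (pairing (X n) y - 0) < e" by auto
  qed
qed

lemma weakly_null_perturb:
  assumes X: "\<And>n. X n \<in> lp p" "\<And>n. X' n \<in> lp p" and null: "weakly_null q X"
    and lim: "(\<lambda>n. lp_norm p (X' n - X n)) \<longlonglongrightarrow> 0"
  shows "weakly_null q X'"
  unfolding weakly_null_def
proof
  fix y assume y: "y \<in> lp q"
  have "(\<lambda>n. pairing (X' n - X n) y) \<longlonglongrightarrow> 0"
  proof (rule Lim_null_comparison)
    show "(\<lambda>n. lp_norm p (X' n - X n) * lp_norm q y) \<longlonglongrightarrow> 0"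
      using tendsto_mult_right[OF lim, of "lp_norm q y"] by simp
    show "\<forall>\<^sub>F n in sequentially. cmod (pairing (X' n - X n) y) \<le> lp_norm p (X' n - X n) * lp_norm q y"
      using X y p_gt_1 by (intro always_eventually allI norm_pairing_le lp_diff) auto
  qed
  moreover have "(\<lambda>n. pairing (X n) y) \<longlonglongrightarrow> 0" using null y by (simp add: weakly_null_def)
  ultimately have "(\<lambda>n. pairing (X' n - X n) y + pairing (X n) y) \<longlonglongrightarrow> 0 + 0" by (rule tendsto_add)
  then show "(\<lambda>n. pairing (X' n) y) \<longlonglongrightarrow> 0"
    using X y by (simp add: pairing_diff_left)
qed

lemma mult_cnj_duality_map: "x j * cnj (duality_map p x j) = of_real (cmod (x j) powr p)"
proof (cases "x j = 0")
  case False
  have "x j * cnj (duality_map p x j) = (x j * cnj (x j)) * of_real (cmod (x j) powr (p - 2))"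
    by (simp add: duality_map_def)
  also have "\<dots> = of_real ((cmod (x j))\<^sup>2 * cmod (x j) powr (p - 2))"
    by (simp only: complex_norm_square[symmetric] of_real_mult)
  also have "(cmod (x j))\<^sup>2 * cmod (x j) powr (p - 2) = cmod (x j) powr 2 * cmod (x j) powr (p - 2)"
    using False by simp
  also have "\<dots> = cmod (x j) powr p" unfolding powr_add[symmetric] by simp
  finally show ?thesis .
qed (simp add: duality_map_def)

lemma duality_map_powr: "cmod (duality_map p x j) powr q = cmod (x j) powr p"
  using exponent_identities by (simp add: duality_map_norm powr_powr)

lemma duality_map_in_lp: "x \<in> lp p \<Longrightarrow> duality_map p x \<in> lp q"
  by (simp add: lp_def duality_map_powr)

lemma duality_map_lp_norm:
  assumes "x \<in> lp p"
  shows "lp_norm q (duality_map p x) = lp_norm p x powr (p - 1)"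
proof -
  have "(\<Sum>j. cmod (x j) powr p) = lp_norm p x powr p"
    using assms p_gt_1 by (simp add: lp_norm_powr)
  then show ?thesis
    using exponent_identities by (simp add: lp_norm_def[of q] duality_map_powr powr_powr)
qed

lemma pairing_duality_map:
  assumes "x \<in> lp p"
  shows "pairing x (duality_map p x) = of_real (lp_norm p x powr p)"
proof -
  have "(\<lambda>j. complex_of_real (cmod (x j) powr p)) sums of_real (lp_norm p x powr p)"
    unfolding sums_of_real_iff using assms p_gt_1
    by (simp add: lp_norm_powr lp_def summable_sums)
  then show ?thesis by (simp add: pairing_def mult_cnj_duality_map sums_iff)
qed

section \<open>Bounded functionals\<close>

text \<open>
  The Riesz representation of the dual of \<open>\<ell>\<^sub>p\<close>. The coordinates of \<open>y\<close> are the conjugated values of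
  \<open>\<phi>\<close> on the unit sequences. Testing \<open>\<phi>\<close> on the dual vector of a truncation \<open>z\<close> of \<open>y\<close> gives
  \<open>\<parallel>z\<parallel>\<^sup>q \<le> K \<parallel>z\<parallel>\<^sup>q\<^sup>-\<^sup>1\<close>, so \<open>\<parallel>z\<parallel> \<le> K\<close> for all truncations, and \<open>y\<close> lies in \<open>\<ell>\<^sub>q\<close>. The two functionals
  agree on finitely supported sequences, and these are dense.
\<close>

lemma bounded_functional_is_pairing:
  assumes add: "\<And>x y. x \<in> lp p \<Longrightarrow> y \<in> lp p \<Longrightarrow> \<phi> (x + y) = \<phi> x + \<phi> y"
    and scale: "\<And>c x. x \<in> lp p \<Longrightarrow> \<phi> (cscale c x) = c * \<phi> x"
    and bound: "\<And>x. x \<in> lp p \<Longrightarrow> cmod (\<phi> x) \<le> K * lp_norm p x"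
  obtains y where "y \<in> lp q" "\<And>x. x \<in> lp p \<Longrightarrow> \<phi> x = pairing x y"
proof
  define y where "y = (\<lambda>j. cnj (\<phi> (unit_seq j)))"
  have K0: "0 \<le> K"
  proof -
    have "lp_norm p (unit_seq 0) \<noteq> 0"
      using p_gt_1 by (simp add: lp_norm_eq_0_iff unit_seq_in_lp) (auto simp: unit_seq_def fun_eq_iff)
    then have "0 < lp_norm p (unit_seq 0)" using lp_norm_nonneg[of p "unit_seq 0"] by simp
    moreover have "0 \<le> K * lp_norm p (unit_seq 0)"
      using bound[OF unit_seq_in_lp, of 0] norm_ge_zero by (rule order_trans[rotated])
    ultimately show ?thesis by (simp add: zero_le_mult_iff)
  qed
  have finite: "(\<Sum>k<N. cscale (x k) (unit_seq k)) \<in> lp p \<and>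
      \<phi> (\<Sum>k<N. cscale (x k) (unit_seq k)) = (\<Sum>k<N. x k * \<phi> (unit_seq k))" for N x
  proof (induction N)
    case 0
    have "\<phi> (cscale 0 0) = 0 * \<phi> 0" by (rule scale[OF lp_zero])
    then show ?case using lp_zero[of p] by (simp add: cscale_def zero_fun_def)
  next
    case (Suc N)
    have u: "cscale (x N) (unit_seq N) \<in> lp p" by (intro lp_scale unit_seq_in_lp)
    show ?case
      unfolding sum.lessThan_Suc
      using Suc.IH u p_gt_1 lp_add[of p _ "cscale (x N) (unit_seq N)"] scale[OF unit_seq_in_lp]
      by (simp only: add less_imp_le)
  qed
  have trunc: "\<phi> (trunc N x) = pairing (trunc N x) y" for N x
  proof -
    have "pairing (trunc N x) y = (\<Sum>k<N. x k * \<phi> (unit_seq k))"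
      unfolding pairing_def
      by (subst suminf_finite[of "{..<N}"]) (auto simp: trunc_def y_def)
    then show ?thesis using finite[of x N] by (simp add: trunc_eq_sum)
  qed
  show y: "y \<in> lp q"
  proof -
    have "(\<Sum>j<N. cmod (y j) powr q) \<le> K powr q" for N
    proof -
      define z where "z = trunc N y"
      define x where "x = duality_map q z"
      interpret d: conjugate_exponents q p by (rule dual)
      have z: "z \<in> lp q" by (simp add: z_def trunc_in_lp)
      have x: "x \<in> lp p" unfolding x_def by (rule d.duality_map_in_lp[OF z])
      define s where "s = lp_norm q z"
      have "trunc N x = x"
        by (auto simp: x_def z_def trunc_def duality_map_def fun_eq_iff)
      then have "\<phi> x = pairing x y" using trunc[of N x] by simp
      also have "\<dots> = pairing x z"
        unfolding pairing_def
        by (rule arg_cong[where f = suminf]) (auto simp: x_def z_def trunc_def duality_map_def fun_eq_iff)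
      also have "\<dots> = cnj (pairing z x)" using z x by (simp add: d.pairing_commute)
      also have "\<dots> = of_real (s powr q)"
        unfolding x_def s_def by (simp add: d.pairing_duality_map[OF z])
      finally have "s powr q \<le> K * s powr (q - 1)"
        using bound[OF x] d.duality_map_lp_norm[OF z] by (simp add: x_def s_def)
      then have "s \<le> K"
      proof (cases "s = 0")
        case False
        then have "0 < s" using lp_norm_nonneg[of q z] by (simp add: s_def)
        then have "s * s powr (q - 1) \<le> K * s powr (q - 1)"
          using \<open>s powr q \<le> K * s powr (q - 1)\<close> by (simp add: powr_diff)
        then show ?thesis using \<open>0 < s\<close> by simp
      qed (use K0 in simp)
      then have "s powr q \<le> K powr q"
        using q_gt_1 lp_norm_nonneg[of q z] by (intro powr_mono2) (auto simp: s_def)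
      moreover have "s powr q = (\<Sum>j<N. cmod (y j) powr q)"
      proof -
        have "s powr q = (\<Sum>j. cmod (z j) powr q)"
          unfolding s_def using q_gt_1 z by (intro lp_norm_powr) auto
        also have "\<dots> = (\<Sum>j<N. cmod (z j) powr q)"
          using q_gt_1 by (intro suminf_finite) (auto simp: z_def trunc_def)
        finally show ?thesis by (simp add: z_def trunc_def)
      qed
      ultimately show ?thesis by simp
    qed
    then show ?thesis
      unfolding lp_def
      by (auto intro!: bounded_imp_summable[where B = "K powr q"] simp: lessThan_Suc_atMost[symmetric] simp del: sum.lessThan_Suc)
  qed
  fix x assume x: "x \<in> lp p"
  let ?r = "\<lambda>N. lp_norm p (x - trunc N x)"
  have p1: "1 \<le> p" using p_gt_1 by simp
  have r: "x - trunc N x \<in> lp p" for N using x p1 by (intro lp_diff trunc_in_lp)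
  have le: "cmod (\<phi> x - pairing x y) \<le> K * ?r N + ?r N * lp_norm q y" for N
  proof -
    have x_eq: "x = trunc N x + (x - trunc N x)" by simp
    have "\<phi> x = \<phi> (trunc N x) + \<phi> (x - trunc N x)"
      using add[OF trunc_in_lp r, of N x N] by simp
    moreover have "pairing x y = pairing (trunc N x) y + pairing (x - trunc N x) y"
      using pairing_add_left[OF trunc_in_lp r y, of N x N] by simp
    ultimately have "\<phi> x - pairing x y = \<phi> (x - trunc N x) - pairing (x - trunc N x) y"
      by (simp add: trunc)
    then show ?thesis
      using bound[OF r[of N]] norm_pairing_le[OF r[of N] y]
        norm_triangle_ineq4[of "\<phi> (x - trunc N x)" "pairing (x - trunc N x) y"] by simp
  qed
  have "(\<lambda>N. K * ?r N + ?r N * lp_norm q y) \<longlonglongrightarrow> K * 0 + 0 * lp_norm q y"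
    using p_gt_1 by (intro tendsto_intros lp_norm_tail_tendsto_0 x) auto
  then have "cmod (\<phi> x - pairing x y) \<le> 0"
    using le by (intro LIMSEQ_le_const[where x = "K * 0 + 0 * lp_norm q y", simplified]) auto
  then show "\<phi> x = pairing x y" by simp
qed

text \<open>
  The functional is the coefficient of \<open>b\<close> in the decomposition of a vector along \<open>H\<close> and \<open>b\<close>; it
  is bounded by the coefficient bound, and so it is represented by an element of \<open>\<ell>\<^sub>q\<close>.
\<close>

lemma separating_functional:
  assumes H: "cseq.subspace H" "closedin (lp_topology p) H" and b: "b \<in> lp p" "b \<notin> H"
    and spans: "cseq.span (insert b H) = lp p"
  obtains y where "y \<in> lp q" "\<And>h. h \<in> H \<Longrightarrow> pairing h y = 0" "pairing b y = 1"
proof -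
  have p1: "1 \<le> p" using p_gt_1 by simp
  have sub: "H \<subseteq> lp p" using H(2) closedin_lp_iff[OF p1] by blast
  obtain d where d: "0 < d" "\<And>m. m \<in> H \<Longrightarrow> d \<le> lp_norm p (b - m)"
    using distance_pos[OF p1 H(2) b] by blast
  have ex: "\<exists>t. x - cscale t b \<in> H" if "x \<in> lp p" for x
    using that unfolding spans[symmetric]
    by (simp add: cseq.span_breakdown_eq cseq.span_eq_iff[THEN iffD2, OF H(1)])
  define \<phi> where "\<phi> x = (SOME t. x - cscale t b \<in> H)" for x
  have \<phi>: "x - cscale (\<phi> x) b \<in> H" if "x \<in> lp p" for x
    unfolding \<phi>_def by (rule someI_ex[OF ex[OF that]])
  have uniq: "\<phi> x = t" if "x \<in> lp p" "x - cscale t b \<in> H" for x t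
  proof -
    have "(x - cscale t b) - (x - cscale (\<phi> x) b) \<in> H"
      by (intro cseq.subspace_diff H that \<phi>)
    also have "(x - cscale t b) - (x - cscale (\<phi> x) b) = 0 - cscale (t - \<phi> x) b"
      by (auto simp: fun_eq_iff cscale_def algebra_simps)
    finally have "cmod (t - \<phi> x) * d \<le> lp_norm p 0"
      using coefficient_bound[OF p1 H(1) sub b(1) d, of 0 "t - \<phi> x"] by blast
    then have "cmod (t - \<phi> x) * d \<le> 0" using p_gt_1 by (simp add: lp_norm_def)
    then show ?thesis using d(1) by (simp add: mult_le_0_iff)
  qed
  obtain y where y: "y \<in> lp q" "\<And>x. x \<in> lp p \<Longrightarrow> \<phi> x = pairing x y"
  proof (rule bounded_functional_is_pairing[of \<phi> "1 / d"])
    fix x y assume xy: "x \<in> lp p" "y \<in> lp p"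
    have "(x - cscale (\<phi> x) b) + (y - cscale (\<phi> y) b) \<in> H"
      by (intro cseq.subspace_add H \<phi> xy)
    also have "(x - cscale (\<phi> x) b) + (y - cscale (\<phi> y) b) = (x + y) - cscale (\<phi> x + \<phi> y) b"
      by (auto simp: fun_eq_iff cscale_def algebra_simps)
    finally show "\<phi> (x + y) = \<phi> x + \<phi> y" using xy p1 by (intro uniq lp_add)
  next
    fix c x assume x: "x \<in> lp p"
    have "cscale c (x - cscale (\<phi> x) b) \<in> H" by (intro cseq.subspace_scale H \<phi> x)
    also have "cscale c (x - cscale (\<phi> x) b) = cscale c x - cscale (c * \<phi> x) b"
      by (auto simp: fun_eq_iff cscale_def algebra_simps)
    finally show "\<phi> (cscale c x) = c * \<phi> x" using x by (intro uniq lp_scale)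
  next
    fix x assume x: "x \<in> lp p"
    show "cmod (\<phi> x) \<le> 1 / d * lp_norm p x"
      using coefficient_bound[OF p1 H(1) sub b(1) d \<phi>[OF x]] d(1) by (simp add: field_simps)
  qed blast
  have "pairing h y = 0" if "h \<in> H" for h
    using uniq[of h 0] y(2)[of h] that sub by (auto simp: cscale_def zero_fun_def[symmetric])
  moreover have "pairing b y = 1"
    using uniq[of b 1] y(2)[of b] b(1) cseq.subspace_0[OF H(1)] by simp
  ultimately show ?thesis using y(1) that by blast
qed

section \<open>Subspaces of finite codimension\<close>

text \<open>
  A complement \<open>C\<close> of least cardinality consisting of unit sequences is independent modulo \<open>M\<close>.
  Hence each \<open>c\<close> in \<open>C\<close> has a functional \<open>Y c\<close> that is \<open>1\<close> at \<open>c\<close> and vanishes on \<open>M\<close> and on the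
  rest of \<open>C\<close>. Subtracting these coordinates projects \<open>\<ell>\<^sub>p\<close> onto \<open>M\<close>.
\<close>

lemma finite_codim_projection:
  assumes "finite_codim_subspace p M"
  obtains C Y where "finite C" "C \<subseteq> range unit_seq" "\<And>c. c \<in> C \<Longrightarrow> Y c \<in> lp q"
    "\<And>x. x \<in> lp p \<Longrightarrow> x - (\<Sum>c\<in>C. cscale (pairing x (Y c)) c) \<in> M"
proof -
  have p1: "1 \<le> p" using p_gt_1 by simp
  obtain B where M: "M \<subseteq> lp p" "cseq.subspace M" "closedin (lp_topology p) M"
    and B: "finite B" "B \<subseteq> lp p" "cseq.span (M \<union> B) = lp p"
    using assms unfolding finite_codim_subspace_def by blast
  define complement where
    "complement C \<longleftrightarrow> finite C \<and> C \<subseteq> range unit_seq \<and> cseq.span (M \<union> C) = lp p" for C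
  obtain C0 where "complement C0"
    using unit_seq_complement[OF p1 B(1,2) M(2,3) B(3)] unfolding complement_def by blast
  then obtain C where C: "complement C" and minimal: "\<And>D. complement D \<Longrightarrow> card C \<le> card D"
    using ex_has_least_nat[of complement C0 card] by blast
  have fin: "finite C" and units: "C \<subseteq> range unit_seq" and spans: "cseq.span (M \<union> C) = lp p"
    using C by (auto simp: complement_def)
  have Clp: "C \<subseteq> lp p" using units unit_seq_in_lp by auto
  have "\<exists>y. y \<in> lp q \<and> (\<forall>h\<in>M \<union> (C - {c}). pairing h y = 0) \<and> pairing c y = 1" if c: "c \<in> C" for c
  proof -
    define H where "H = cseq.span (M \<union> (C - {c}))"
    have ins: "insert c (M \<union> (C - {c})) = M \<union> C" using c by auto
    have "c \<notin> H"
    proof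
      assume "c \<in> H"
      then have "complement (C - {c})"
        using cseq.span_redundant[of c "M \<union> (C - {c})"] fin units spans
        by (auto simp: H_def ins complement_def)
      then show False using minimal fin c by (meson card_Diff1_less not_less)
    qed
    moreover have "cseq.span (insert c H) = lp p"
      unfolding H_def using span_span_Un[of "M \<union> (C - {c})" "{c}"] ins spans by simp
    moreover have "closedin (lp_topology p) H"
      unfolding H_def using Clp fin M by (intro closed_span_Un_finite p1) auto
    ultimately obtain y where "y \<in> lp q" "\<And>h. h \<in> H \<Longrightarrow> pairing h y = 0" "pairing c y = 1"
      using separating_functional[of H c] c Clp by (auto simp: H_def)
    then show ?thesis unfolding H_def by (meson cseq.span_base)
  qed
  then obtain Y where Y: "\<And>c. c \<in> C \<Longrightarrow> Y c \<in> lp q"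
    "\<And>c h. c \<in> C \<Longrightarrow> h \<in> M \<union> (C - {c}) \<Longrightarrow> pairing h (Y c) = 0"
    "\<And>c. c \<in> C \<Longrightarrow> pairing c (Y c) = 1" by metis
  define R where "R x = (\<Sum>c\<in>C. cscale (pairing x (Y c)) c)" for x
  have R_add: "R (x + y) = R x + R y" if "x \<in> lp p" "y \<in> lp p" for x y
    unfolding R_def sum.distrib[symmetric]
    by (intro sum.cong refl) (simp add: pairing_add_left that Y cseq.scale_left_distrib)
  have R_scale: "R (cscale k x) = cscale k (R x)" if "x \<in> lp p" for k x
    unfolding R_def cseq.scale_sum_right
    by (intro sum.cong refl) (simp add: pairing_scale_left that Y)
  define good where "good x \<longleftrightarrow> x \<in> lp p \<and> x - R x \<in> M" for x
  have "good x" if "x \<in> cseq.span (M \<union> C)" for x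
    using that
  proof (induction rule: cseq.span_induct_alt)
    case base
    have "R 0 = 0" using R_scale[OF lp_zero, of 0] by simp
    then show ?case
      unfolding good_def using lp_zero cseq.subspace_0[OF M(2)] by (simp only: diff_zero simp_thms)
  next
    case (step k x y)
    have x: "x \<in> lp p" using step M Clp by auto
    have y: "y \<in> lp p" "y - R y \<in> M" using step by (auto simp only: good_def)
    have "x - R x \<in> M"
    proof (cases "x \<in> M")
      case True
      then have "R x = 0" unfolding R_def by (intro sum.neutral) (simp add: Y)
      then show ?thesis using True by simp
    next
      case False
      then have xC: "x \<in> C" using step by auto
      have "R x = (\<Sum>c\<in>C. if c = x then x else 0)"
        unfolding R_def using xC by (intro sum.cong refl) (simp add: Y)
      then show ?thesis using xC fin M by (simp add: cseq.subspace_0)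
    qed
    then have "cscale k (x - R x) + (y - R y) \<in> M"
      using M y by (intro cseq.subspace_add cseq.subspace_scale)
    moreover have "cscale k x + y - R (cscale k x + y) = cscale k (x - R x) + (y - R y)"
      using x y by (simp add: R_add R_scale lp_scale cseq.scale_right_diff_distrib algebra_simps)
    ultimately show ?case unfolding good_def using lp_add[OF p1 lp_scale[OF x] y(1)] by (simp only: simp_thms)
  qed
  then have "x - (\<Sum>c\<in>C. cscale (pairing x (Y c)) c) \<in> M" if "x \<in> lp p" for x
    using that unfolding good_def R_def spans by blast
  then show ?thesis using that fin units Y(1) by blast
qed

text \<open>
  The projection onto \<open>M\<close> differs from the identity by finitely many functionals of \<open>\<ell>\<^sub>q\<close>, and these
  tend to zero along a weakly null sequence. The correction is supported on finitely many
  coordinates, so finite supports are preserved.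
\<close>

lemma weakly_null_near_finite_codim_subspace:
  assumes M: "finite_codim_subspace p M" and X: "\<And>n. X n \<in> lp p" and null: "weakly_null q X"
  obtains X' where "\<And>n. X' n \<in> M" "(\<lambda>n. lp_norm p (X' n - X n)) \<longlonglongrightarrow> 0"
    "\<And>n. finite {j. X' n j \<noteq> X n j}"
proof -
  have p1: "1 \<le> p" using p_gt_1 by simp
  obtain C Y where C: "finite C" "C \<subseteq> range unit_seq" "\<And>c. c \<in> C \<Longrightarrow> Y c \<in> lp q"
    and proj: "\<And>x. x \<in> lp p \<Longrightarrow> x - (\<Sum>c\<in>C. cscale (pairing x (Y c)) c) \<in> M"
    using finite_codim_projection[OF M] by blast
  define X' where "X' n = X n - (\<Sum>c\<in>C. cscale (pairing (X n) (Y c)) c)" for n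
  have Clp: "c \<in> lp p" if "c \<in> C" for c using that C unit_seq_in_lp by auto
  have le: "lp_norm p (X' n - X n) \<le> (\<Sum>c\<in>C. cmod (pairing (X n) (Y c)) * lp_norm p c)" for n
  proof -
    have "lp_norm p (X' n - X n) = lp_norm p (\<Sum>c\<in>C. cscale (pairing (X n) (Y c)) c)"
      unfolding X'_def lp_norm_def by simp
    also have "\<dots> \<le> (\<Sum>c\<in>C. lp_norm p (cscale (pairing (X n) (Y c)) c))"
      by (rule lp_norm_sum_le[OF p1 lp_scale[OF Clp]])
    also have "\<dots> = (\<Sum>c\<in>C. cmod (pairing (X n) (Y c)) * lp_norm p c)"
      using p_gt_1 by (intro sum.cong refl lp_norm_scale Clp) auto
    finally show ?thesis .
  qed
  have lim: "(\<lambda>n. lp_norm p (X' n - X n)) \<longlonglongrightarrow> 0"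
  proof (rule Lim_null_comparison)
    have "(\<lambda>n. \<Sum>c\<in>C. cmod (pairing (X n) (Y c)) * lp_norm p c) \<longlonglongrightarrow> (\<Sum>c\<in>C. 0 * lp_norm p c)"
      using null C(3) unfolding weakly_null_def
      by (intro tendsto_sum tendsto_mult tendsto_norm_zero tendsto_const) blast
    then show "(\<lambda>n. \<Sum>c\<in>C. cmod (pairing (X n) (Y c)) * lp_norm p c) \<longlonglongrightarrow> 0"
      by simp
    show "\<forall>\<^sub>F n in sequentially. norm (lp_norm p (X' n - X n)) \<le>
        (\<Sum>c\<in>C. cmod (pairing (X n) (Y c)) * lp_norm p c)"
      using le unfolding real_norm_def abs_of_nonneg[OF lp_norm_nonneg] by (rule always_eventually[OF allI])
  qed
  have fin: "finite {j. X' n j \<noteq> X n j}" for n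
  proof (rule finite_subset)
    show "{j. X' n j \<noteq> X n j} \<subseteq> (\<Union>c\<in>C. {j. c j \<noteq> 0})"
    proof
      fix j assume "j \<in> {j. X' n j \<noteq> X n j}"
      then have "(\<Sum>c\<in>C. pairing (X n) (Y c) * c j) \<noteq> 0"
        by (simp add: X'_def sum_fun_apply cscale_def)
      then obtain c where "c \<in> C" "pairing (X n) (Y c) * c j \<noteq> 0"
        by (rule sum.not_neutral_contains_not_neutral)
      then show "j \<in> (\<Union>c\<in>C. {j. c j \<noteq> 0})" by auto
    qed
    have "finite {j. c j \<noteq> 0}" if c: "c \<in> C" for c
    proof -
      obtain k where k: "c = unit_seq k" using subsetD[OF C(2) c] by (rule rangeE)
      have "{j. c j \<noteq> 0} \<subseteq> {k}" unfolding k unit_seq_def by auto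
      then show ?thesis by (rule finite_subset) simp
    qed
    then show "finite (\<Union>c\<in>C. {j. c j \<noteq> 0})" using C(1) by blast
  qed
  show ?thesis by (rule that[of X', OF _ lim fin]) (use proj X in \<open>simp only: X'_def\<close>)
qed

text \<open>
  The annihilator is the common kernel of finitely many continuous functionals. Adding one more
  functional \<open>b\<close> raises the codimension by at most one: if \<open>b\<close> does not vanish on the kernel \<open>N B\<close>
  of the others, any \<open>g\<close> in \<open>N B\<close> with nonzero pairing complements the new kernel in \<open>N B\<close>.
  
  This turns a statement about annihilators of finite-dimensional subspaces into one about
  finite-codimensional subspaces of the dual space.
\<close>

lemma finite_codim_annihilator:
  assumes "finite_dim_subspace q F"
  shows "finite_codim_subspace p (annihilator p F)"
proof -
  have p1: "1 \<le> p" using p_gt_1 by simp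
  obtain B where B: "finite B" "B \<subseteq> lp q" and F: "F = cseq.span B"
    using assms unfolding finite_dim_subspace_def by blast
  define N where "N B = {x \<in> lp p. \<forall>b\<in>B. pairing x b = 0}" for B
  have "annihilator p F = N B"
  proof -
    have "(\<forall>f\<in>F. pairing f x = 0) \<longleftrightarrow> (\<forall>b\<in>B. pairing x b = 0)" if x: "x \<in> lp p" for x
    proof -
      interpret d: conjugate_exponents q p by (rule dual)
      have comm: "pairing b x = 0 \<longleftrightarrow> pairing x b = 0" if "b \<in> lp q" for b
        using x that by (simp add: pairing_commute)
      have "f \<in> {y \<in> lp q. pairing y x = 0}" if B0: "\<forall>b\<in>B. pairing x b = 0" and f: "f \<in> cseq.span B" for f
      proof -
        have "cseq.subspace {y \<in> lp q. pairing y x = 0}"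
          using x q_gt_1
          by (intro cseq.subspaceI)
            (simp_all add: lp_zero lp_add lp_scale d.pairing_add_left d.pairing_scale_left, simp add: pairing_def)
        moreover have "B \<subseteq> {y \<in> lp q. pairing y x = 0}" using B0 B(2) comm by blast
        ultimately show ?thesis using f cseq.span_minimal by blast
      qed
      then have "pairing f x = 0" if "\<forall>b\<in>B. pairing x b = 0" "f \<in> F" for f
        using that unfolding F by blast
      moreover have "pairing x b = 0" if "\<forall>f\<in>F. pairing f x = 0" "b \<in> B" for b
        using that comm[of b] B(2) cseq.span_base[of b B] unfolding F by blast
      ultimately show ?thesis by blast
    qed
    then show ?thesis by (auto simp: annihilator_def N_def)
  qed
  moreover have sub: "cseq.subspace (N B)" if "B \<subseteq> lp q" for B
  proof (rule cseq.subspaceI)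
    show "0 \<in> N B" by (simp add: N_def lp_zero pairing_def)
    show "x + y \<in> N B" if "x \<in> N B" "y \<in> N B" for x y
      using that \<open>B \<subseteq> lp q\<close> p1 by (auto simp: N_def lp_add pairing_add_left subset_iff)
    show "cscale c x \<in> N B" if "x \<in> N B" for c x
      using that \<open>B \<subseteq> lp q\<close> by (auto simp: N_def lp_scale pairing_scale_left subset_iff)
  qed
  moreover have "closedin (lp_topology p) (N B)"
    unfolding closedin_lp_iff[OF p1]
  proof (intro conjI ballI impI)
    show "N B \<subseteq> lp p" by (auto simp: N_def)
    fix x assume x: "x \<in> lp p" and approx: "\<forall>e>0. \<exists>m\<in>N B. lp_norm p (x - m) < e"
    have "pairing x b = 0" if b: "b \<in> B" for b
    proof (rule ccontr)
      assume nz: "pairing x b \<noteq> 0"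
      \<comment> \<open>The summand \<open>1\<close> makes \<open>L\<close> positive without deciding whether \<open>b\<close> is zero.\<close>
      define L where "L = lp_norm q b + 1"
      have L: "0 < L" "lp_norm q b \<le> L" using lp_norm_nonneg[of q b] by (auto simp: L_def)
      obtain m where m: "m \<in> N B" "lp_norm p (x - m) < cmod (pairing x b) / L"
        using approx[rule_format, of "cmod (pairing x b) / L"] nz L by auto
      have mlp: "m \<in> lp p" "pairing m b = 0" using m b by (auto simp: N_def)
      have blp: "b \<in> lp q" using b B by auto
      have "cmod (pairing x b) = cmod (pairing (x - m) b)"
        using mlp x blp by (simp add: pairing_diff_left)
      also have "\<dots> \<le> lp_norm p (x - m) * lp_norm q b"
        using x mlp blp p1 by (intro norm_pairing_le lp_diff)
      also have "\<dots> \<le> lp_norm p (x - m) * L"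
        using L by (intro mult_left_mono lp_norm_nonneg)
      also have "\<dots> < cmod (pairing x b)" using m(2) L by (simp add: field_simps)
      finally show False by simp
    qed
    then show "x \<in> N B" using x by (simp add: N_def)
  qed
  moreover have "\<exists>C. finite C \<and> C \<subseteq> lp p \<and> cseq.span (N B \<union> C) = lp p"
    using B
  proof (induction B)
    case empty
    show ?case
      using subspace_lp[OF p1] by (intro exI[of _ "{}"]) (simp add: N_def)
  next
    case (insert b B)
    then obtain C where C: "finite C" "C \<subseteq> lp p" "cseq.span (N B \<union> C) = lp p" by auto
    have blp: "b \<in> lp q" using insert.prems by simp
    show ?case
    proof (cases "\<forall>x\<in>N B. pairing x b = 0")
      case True
      then have "N (insert b B) = N B" by (auto simp: N_def)
      then show ?thesis using C by auto
    next
      case False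
      then obtain g where g: "g \<in> N B" "pairing g b \<noteq> 0" by blast
      let ?S = "cseq.span (N (insert b B) \<union> insert g C)"
      have glp: "g \<in> lp p" using g by (simp add: N_def)
      have "x \<in> ?S" if x: "x \<in> N B" for x
      proof -
        define t where "t = pairing x b / pairing g b"
        have "x - cscale t g \<in> N B"
          using insert.prems x g by (intro cseq.subspace_diff cseq.subspace_scale sub) auto
        moreover have "pairing (x - cscale t g) b = 0"
          using x g glp blp by (simp add: N_def pairing_diff_left pairing_scale_left lp_scale t_def)
        ultimately have "x - cscale t g \<in> N (insert b B)" by (simp add: N_def)
        then have "(x - cscale t g) + cscale t g \<in> ?S"
          by (intro cseq.span_add cseq.span_scale cseq.span_base) auto
        then show ?thesis by simp
      qed
      then have "N B \<union> C \<subseteq> ?S" by (auto intro: cseq.span_base)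
      then have "lp p \<subseteq> ?S" unfolding C(3)[symmetric] by (intro cseq.span_minimal) auto
      moreover have "?S \<subseteq> lp p" using C glp by (intro span_subset_lp p1) (auto simp: N_def)
      ultimately show ?thesis using C glp by (intro exI[of _ "insert g C"]) auto
    qed
  qed
  ultimately show ?thesis
    using B unfolding finite_codim_subspace_def by (auto simp: N_def)
qed

section \<open>Approximation of points of the essential numerical range\<close>

lemma weakly_null_coordinate:
  assumes "weakly_null q X"
  shows "(\<lambda>n. X n j) \<longlonglongrightarrow> 0"
  using assms unit_seq_in_lp[of j q] unfolding weakly_null_def
  by (metis (no_types, lifting) ext pairing_unit_seq_right)

text \<open>
  Although \<^term>\<open>duality_map p\<close> is not linear, it acts coordinatewise, so it preserves convergence to
  zero in each coordinate, and it maps unit vectors to unit vectors. For bounded sequences this is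
  enough for weak convergence.
\<close>

lemma weakly_null_duality_map:
  assumes X: "\<And>n. X n \<in> lp p" "\<And>n. lp_norm p (X n) = 1" and null: "weakly_null q X"
  shows "weakly_null p (\<lambda>n. duality_map p (X n))"
proof (rule conjugate_exponents.weakly_null_of_bounded_coordinatewise[OF dual])
  show "duality_map p (X n) \<in> lp q" for n by (rule duality_map_in_lp[OF X(1)])
  show "lp_norm q (duality_map p (X n)) \<le> 1" for n
    by (simp add: duality_map_lp_norm[OF X(1)] X(2))
  show "(\<lambda>n. duality_map p (X n) j) \<longlonglongrightarrow> 0" for j
  proof (rule tendsto_norm_zero_cancel)
    have "(\<lambda>n. cmod (X n j) powr (p - 1)) \<longlonglongrightarrow> 0 powr (p - 1)"
      using p_gt_1 weakly_null_coordinate[OF null]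
      by (intro tendsto_powr' tendsto_norm_zero tendsto_const) (auto intro: always_eventually)
    then show "(\<lambda>n. cmod (duality_map p (X n) j)) \<longlonglongrightarrow> 0"
      by (simp add: duality_map_norm)
  qed
qed

lemma finitely_supported_approximation:
  assumes X: "\<And>n. X n \<in> lp p"
  obtains X' where "\<And>n. X' n \<in> lp p" "\<And>n. finite {j. X' n j \<noteq> 0}"
    "(\<lambda>n. lp_norm p (X' n - X n)) \<longlonglongrightarrow> 0"
proof -
  have "\<exists>N. lp_norm p (X n - trunc N (X n)) < 1 / Suc n" for n
    using order_tendstoD(2)[OF lp_norm_tail_tendsto_0[OF _ X[of n]], of "1 / Suc n"] p_gt_1
    by (auto simp: eventually_sequentially)
  then obtain N where N: "\<And>n. lp_norm p (X n - trunc (N n) (X n)) < 1 / Suc n" by metis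
  show ?thesis
  proof
    show "trunc (N n) (X n) \<in> lp p" for n by (rule trunc_in_lp)
    show "finite {j. trunc (N n) (X n) j \<noteq> 0}" for n
      by (rule finite_subset[of _ "{..<N n}"]) (auto simp: trunc_def)
    show "(\<lambda>n. lp_norm p (trunc (N n) (X n) - X n)) \<longlonglongrightarrow> 0"
    proof (rule Lim_null_comparison)
      show "(\<lambda>n. 1 / real (Suc n)) \<longlonglongrightarrow> 0" by (rule LIMSEQ_Suc[OF lim_1_over_n])
      show "\<forall>\<^sub>F n in sequentially. norm (lp_norm p (trunc (N n) (X n) - X n)) \<le> 1 / real (Suc n)"
        using less_imp_le[OF N] by (intro always_eventually allI)
          (simp add: lp_norm_nonneg lp_norm_minus_commute[of p "trunc _ _"])
    qed
  qed
qed

text \<open>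
  Starting from a sequence \<open>X n\<close> that witnesses \<open>\<mu>\<close>, first truncate and then correct \<open>X n\<close> to
  \<open>V n\<close> in \<open>M\<close> with finite support, and correct the functional \<open>J n\<close> dual to \<open>X n\<close> to \<open>W n\<close> in the
  annihilator of \<open>F\<close>. Both corrections are small in norm because \<open>X n\<close> and \<open>J n\<close> are weakly null.
  The functional \<open>W n\<close> is not the dual vector of \<open>V n\<close>, but all the required quantities depend
  continuously on the pair \<open>(V n, W n)\<close>, and a rescaling of both makes the normalisations exact.
\<close>

lemma essential_numerical_range_imp_approximation:
  assumes T: "bounded_operator p T" and \<mu>: "\<mu> \<in> essential_numerical_range p q T"
    and M: "finite_codim_subspace p M" and F: "finite_dim_subspace p F" and \<epsilon>: "0 < \<epsilon>"
  shows "\<exists>x xs. x \<in> M \<and> finite {j. x j \<noteq> 0} \<and> xs \<in> annihilator q F \<and>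
          lp_norm p x = 1 \<and> pairing x xs = 1 \<and> lp_norm q xs < 1 + \<epsilon> \<and>
          cmod (pairing (T x) xs - \<mu>) < \<epsilon>"
proof -
  interpret d: conjugate_exponents q p by (rule dual)
  have p1: "1 \<le> p" and q1: "1 \<le> q" using p_gt_1 q_gt_1 by auto
  obtain X where X: "\<And>n. X n \<in> lp p" "\<And>n. lp_norm p (X n) = 1" and null: "weakly_null q X"
    and lim: "(\<lambda>n. pairing (T (X n)) (duality_map p (X n))) \<longlonglongrightarrow> \<mu>"
    using \<mu> unfolding essential_numerical_range_def by blast
  have Mlp: "M \<subseteq> lp p" and Msub: "cseq.subspace M" using M by (auto simp: finite_codim_subspace_def)
  define J where "J n = duality_map p (X n)" for n
  have J: "J n \<in> lp q" "lp_norm q (J n) = 1" for n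
    unfolding J_def by (rule duality_map_in_lp[OF X(1)]) (simp add: duality_map_lp_norm[OF X(1)] X(2))
  obtain U where U: "\<And>n. U n \<in> lp p" "\<And>n. finite {j. U n j \<noteq> 0}"
    and limU: "(\<lambda>n. lp_norm p (U n - X n)) \<longlonglongrightarrow> 0"
    by (rule finitely_supported_approximation[of X, OF X(1)]) (rule that)
  obtain V where V: "\<And>n. V n \<in> M" "\<And>n. finite {j. V n j \<noteq> U n j}"
    and limV: "(\<lambda>n. lp_norm p (V n - U n)) \<longlonglongrightarrow> 0"
    by (rule weakly_null_near_finite_codim_subspace
        [of M U, OF M U(1) weakly_null_perturb[of X U, OF X(1) U(1) null limU]]) (rule that)
  have ann: "finite_codim_subspace q (annihilator q F)" by (rule d.finite_codim_annihilator[OF F])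
  obtain W where W: "\<And>n. W n \<in> annihilator q F" and limW: "(\<lambda>n. lp_norm q (W n - J n)) \<longlonglongrightarrow> 0"
    by (rule d.weakly_null_near_finite_codim_subspace
        [of _ J, OF ann J(1) weakly_null_duality_map[of X, OF X null, folded J_def]]) (rule that)
  have Vlp: "V n \<in> lp p" for n using V Mlp by auto
  have Wlq: "W n \<in> lp q" for n using W by (auto simp: annihilator_def)
  have Vfin: "finite {j. V n j \<noteq> 0}" for n
    by (rule finite_subset[OF _ finite_UnI[OF V(2)[of n] U(2)[of n]]]) auto
  have limVX: "(\<lambda>n. lp_norm p (V n - X n)) \<longlonglongrightarrow> 0"
  proof (rule Lim_null_comparison)
    show "(\<lambda>n. lp_norm p (V n - U n) + lp_norm p (U n - X n)) \<longlonglongrightarrow> 0"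
      using tendsto_add[OF limV limU] by simp
    have "lp_norm p ((V n - U n) + (U n - X n)) \<le> lp_norm p (V n - U n) + lp_norm p (U n - X n)" for n
      by (intro lp_norm_triangle lp_diff p1 Vlp U X)
    then show "\<forall>\<^sub>F n in sequentially. norm (lp_norm p (V n - X n)) \<le>
        lp_norm p (V n - U n) + lp_norm p (U n - X n)"
      by (intro always_eventually allI) (simp add: lp_norm_nonneg)
  qed
  have normV: "(\<lambda>n. lp_norm p (V n)) \<longlonglongrightarrow> 1"
  proof (rule LIM_zero_cancel, rule Lim_null_comparison[OF _ limVX])
    show "\<forall>\<^sub>F n in sequentially. norm (lp_norm p (V n) - 1) \<le> lp_norm p (V n - X n)"
      using lp_norm_diff_le[OF p1 Vlp X(1)] X(2) by (intro always_eventually allI) (metis real_norm_def)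
  qed
  have normW: "(\<lambda>n. lp_norm q (W n)) \<longlonglongrightarrow> 1"
  proof (rule LIM_zero_cancel, rule Lim_null_comparison[OF _ limW])
    show "\<forall>\<^sub>F n in sequentially. norm (lp_norm q (W n) - 1) \<le> lp_norm q (W n - J n)"
      using lp_norm_diff_le[OF q1 Wlq J(1)] J(2) by (intro always_eventually allI) (metis real_norm_def)
  qed
  define s where "s n = pairing (V n) (W n)" for n
  have lims: "s \<longlonglongrightarrow> 1"
  proof (rule LIM_zero_cancel)
    have "(\<lambda>n. pairing (V n) (W n) - pairing (X n) (J n)) \<longlonglongrightarrow> 0"
      by (rule pairing_difference_tendsto_0[where K = 1, OF Vlp X(1) Wlq J(1) _ _ limVX limW])
        (simp_all add: X J)
    moreover have "pairing (X n) (J n) = 1" for n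
      unfolding J_def by (simp add: pairing_duality_map[OF X(1)] X(2))
    ultimately show "(\<lambda>n. s n - 1) \<longlonglongrightarrow> 0" by (simp add: s_def)
  qed
  obtain K where K: "0 \<le> K" "\<And>x. x \<in> lp p \<Longrightarrow> lp_norm p (T x) \<le> K * lp_norm p x"
    using bounded_operatorE[OF T] by blast
  have Tlp: "T x \<in> lp p" if "x \<in> lp p" for x using T that by (rule bounded_operator_in_lp)
  have limT: "(\<lambda>n. pairing (T (V n)) (W n)) \<longlonglongrightarrow> \<mu>"
  proof -
    have limTV: "(\<lambda>n. lp_norm p (T (V n) - T (X n))) \<longlonglongrightarrow> 0"
    proof (rule Lim_null_comparison)
      show "(\<lambda>n. K * lp_norm p (V n - X n)) \<longlonglongrightarrow> 0" using tendsto_mult_left[OF limVX, of K] by simp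
      show "\<forall>\<^sub>F n in sequentially. norm (lp_norm p (T (V n) - T (X n))) \<le> K * lp_norm p (V n - X n)"
        using K(2)[OF lp_diff[OF p1 Vlp X(1)]] bounded_operator_diff[OF T Vlp X(1)]
        by (intro always_eventually allI) (simp add: lp_norm_nonneg)
    qed
    have bT: "lp_norm p (T (X n)) \<le> max K 1" for n using K(2)[OF X(1), of n] X(2) by simp
    have bJ: "lp_norm q (J n) \<le> max K 1" for n using J by simp
    have "(\<lambda>n. pairing (T (V n)) (W n) - pairing (T (X n)) (J n)) \<longlonglongrightarrow> 0"
      by (rule pairing_difference_tendsto_0[OF Tlp[OF Vlp] Tlp[OF X(1)] Wlq J(1) bT bJ limTV limW])
    from tendsto_add[OF this lim] show ?thesis by (simp add: J_def)
  qed
  have lim1: "(\<lambda>n. lp_norm p (V n) / cmod (s n) * lp_norm q (W n)) \<longlonglongrightarrow> 1 / cmod 1 * 1"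
    by (intro tendsto_intros normV normW lims) simp
  have lim2: "(\<lambda>n. pairing (T (V n)) (W n) / s n) \<longlonglongrightarrow> \<mu> / 1"
    by (intro tendsto_intros limT lims) simp
  have "\<forall>\<^sub>F n in sequentially. lp_norm p (V n) / cmod (s n) * lp_norm q (W n) < 1 + \<epsilon>"
    using order_tendstoD(2)[OF lim1, of "1 + \<epsilon>"] \<epsilon> by simp
  moreover have "\<forall>\<^sub>F n in sequentially. cmod (pairing (T (V n)) (W n) / s n - \<mu>) < \<epsilon>"
    using tendstoD[OF lim2 \<epsilon>] by (simp add: dist_norm)
  moreover have "\<forall>\<^sub>F n in sequentially. 0 < lp_norm p (V n)"
    using order_tendstoD(1)[OF normV, of 0] by simp
  moreover have "\<forall>\<^sub>F n in sequentially. s n \<noteq> 0"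
    using tendsto_imp_eventually_ne[OF lims, of 0] by simp
  ultimately have "\<forall>\<^sub>F n in sequentially. lp_norm p (V n) / cmod (s n) * lp_norm q (W n) < 1 + \<epsilon> \<and>
      cmod (pairing (T (V n)) (W n) / s n - \<mu>) < \<epsilon> \<and> 0 < lp_norm p (V n) \<and> s n \<noteq> 0"
    by eventually_elim simp
  then obtain n where n: "lp_norm p (V n) / cmod (s n) * lp_norm q (W n) < 1 + \<epsilon>"
    "cmod (pairing (T (V n)) (W n) / s n - \<mu>) < \<epsilon>" "0 < lp_norm p (V n)" "s n \<noteq> 0"
    by (auto simp: eventually_sequentially)
  define r where "r = lp_norm p (V n)"
  define x where "x = cscale (1 / of_real r) (V n)"
  \<comment> \<open>The pairing is conjugate-linear in its second argument, hence the conjugate in the scalar.\<close>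
  define xs where "xs = cscale (cnj (of_real r / s n)) (W n)"
  have r: "0 < r" using n by (simp add: r_def)
  have xlp: "x \<in> lp p" unfolding x_def by (rule lp_scale[OF Vlp])
  have Tx: "T x = cscale (1 / of_real r) (T (V n))"
    using T Vlp unfolding x_def bounded_operator_def by blast
  have "x \<in> M" unfolding x_def using Msub V by (intro cseq.subspace_scale)
  moreover have "finite {j. x j \<noteq> 0}"
    by (rule finite_subset[OF _ Vfin[of n]]) (auto simp: x_def cscale_def)
  moreover have "xs \<in> annihilator q F"
    unfolding xs_def using ann W by (intro cseq.subspace_scale) (auto simp: finite_codim_subspace_def)
  moreover have "lp_norm p x = 1"
    unfolding x_def using r p_gt_1 by (simp add: lp_norm_scale Vlp norm_divide r_def[symmetric])
  moreover have "pairing x xs = 1"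
    unfolding x_def xs_def using r n(4)
    by (simp add: pairing_scale_left pairing_scale_right lp_scale Vlp Wlq s_def[symmetric])
  moreover have "lp_norm q xs < 1 + \<epsilon>"
    unfolding xs_def using r n(1) q_gt_1
    by (simp add: lp_norm_scale Wlq norm_divide r_def[symmetric])
  moreover have "pairing (T x) xs = pairing (T (V n)) (W n) / s n"
    unfolding Tx xs_def using r
    by (simp add: pairing_scale_left pairing_scale_right lp_scale Tlp Vlp Wlq)
  ultimately show ?thesis using n(2) by (intro exI[of _ x] exI[of _ xs]) simp
qed

section \<open>Stability in the inequality of Young\<close>

text \<open>
  Summed over the coordinates of a unit vector \<open>x\<close> and some \<open>y\<close> with \<open>\<langle>x, y\<rangle> = 1\<close>, the deficit is
  \<open>1/p + \<parallel>y\<parallel>\<^sup>q / q - 1\<close>, which is small when \<open>\<parallel>y\<parallel>\<close> is close to \<open>1\<close>.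
\<close>

definition young_deficit :: "complex \<Rightarrow> complex \<Rightarrow> real" where
  "young_deficit a b = cmod a powr p / p + cmod b powr q / q - Re (a * cnj b)"

lemma Re_mult_cnj_le: "Re (a * cnj b) \<le> cmod a * cmod b"
  using complex_Re_le_cmod[of "a * cnj b"] by (simp add: norm_mult)

lemma young_deficit_nonneg: "0 \<le> young_deficit a b"
  using Youngs_inequality[OF p_gt_1 q_gt_1 conjugate, of "cmod a" "cmod b"] Re_mult_cnj_le[of a b]
  by (simp add: young_deficit_def)

text \<open>
  A zero of the nonnegative deficit is a minimum, so the derivative in the direction that scales
  \<open>a\<close> vanishes there.
\<close>

lemma young_deficit_critical:
  assumes "young_deficit a b = 0"
  shows "cmod a powr p = Re (a * cnj b)"
proof (cases "a = 0")
  case False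
  define f where "f s = s powr p * (cmod a powr p / p) + cmod b powr q / q - s * Re (a * cnj b)" for s :: real
  have f: "f s = young_deficit (of_real s * a) b" if "0 < s" for s
    using that by (simp add: f_def young_deficit_def norm_mult powr_mult algebra_simps)
  have deriv: "(f has_real_derivative (p * 1 powr (p - 1) * (cmod a powr p / p) - Re (a * cnj b))) (at 1)"
    unfolding f_def by (auto intro!: derivative_eq_intros)
  have minimum: "f 1 \<le> f y" if "\<bar>1 - y\<bar> < 1" for y
  proof -
    have "0 < y" using that by linarith
    then show ?thesis using f[of 1] f[of y] assms young_deficit_nonneg[of "of_real y * a" b] by simp
  qed
  have "p * 1 powr (p - 1) * (cmod a powr p / p) - Re (a * cnj b) = 0"
    by (rule DERIV_local_min[OF deriv zero_less_one]) (use minimum in blast)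
  then show ?thesis using p_gt_1 by simp
qed (use p_gt_1 in simp)

text \<open>
  Criticality in both variables gives \<open>\<bar>a\<bar>\<^sup>p = \<bar>b\<bar>\<^sup>q = Re (a * cnj b)\<close>. The first equation determines the
  modulus of \<open>b\<close>; then \<open>\<bar>a\<bar> \<bar>b\<bar> = Re (a * cnj b)\<close>, which determines its argument.
\<close>

lemma young_deficit_eq_0_imp:
  assumes "young_deficit a b = 0"
  shows "b = dual_point p a"
proof -
  interpret d: conjugate_exponents q p by (rule dual)
  have a: "cmod a powr p = Re (a * cnj b)" by (rule young_deficit_critical[OF assms])
  have "d.young_deficit b a = 0"
    using assms by (simp add: d.young_deficit_def young_deficit_def algebra_simps)
  then have b: "cmod b powr q = Re (a * cnj b)"
    using d.young_deficit_critical[of b a] by (simp add: algebra_simps)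
  show ?thesis
  proof (cases "a = 0")
    case True
    then show ?thesis using b q_gt_1 by (simp add: dual_point_def)
  next
    case False
    have "cmod b = (cmod b powr q) powr (1 / q)" using q_gt_1 by (simp add: powr_powr)
    also have "cmod b powr q = cmod a powr p" by (simp only: a b)
    also have "(cmod a powr p) powr (1 / q) = cmod a powr (p / q)" by (simp add: powr_powr)
    finally have nb: "cmod b = cmod a powr (p - 1)" using exponent_identities by simp
    have "cmod a * cmod b = cmod a powr 1 * cmod a powr (p - 1)" using nb by simp
    also have "\<dots> = cmod a powr p" unfolding powr_add[symmetric] by simp
    finally have "Re (a * cnj b) = cmod (a * cnj b)" using a by (simp add: norm_mult)
    then have "a * cnj b = of_real (cmod a powr p)"
      using a by (metis Im_eq_0 abs_of_nonneg complex_is_Real_iff norm_ge_zero of_real_Re)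
    then have eq: "cnj a * b = of_real (cmod a powr p)"
      by (metis complex_cnj_cnj complex_cnj_complex_of_real complex_cnj_mult)
    have "cmod a powr p = cmod a powr 2 * cmod a powr (p - 2)" unfolding powr_add[symmetric] by simp
    then have "cnj a * b = (a * cnj a) * of_real (cmod a powr (p - 2))"
      using False unfolding eq by (simp add: complex_norm_square[symmetric])
    then have "cnj a * b = cnj a * dual_point p a" by (simp add: dual_point_def)
    then show ?thesis using False by simp
  qed
qed

lemma continuous_young_deficit: "continuous_on UNIV (\<lambda>z. young_deficit (fst z) (snd z))"
  unfolding young_deficit_def using p_gt_1 q_gt_1
  by (intro continuous_intros continuous_on_powr') auto

text \<open>
  All quantities in the stability estimate below are homogeneous of degree one with respect to the
  scaling of \<open>a\<close> by \<open>s\<^sup>1\<^sup>/\<^sup>p\<close> and of \<open>b\<close> by \<open>s\<^sup>1\<^sup>/\<^sup>q\<close>.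
\<close>

lemma young_scaling:
  assumes s: "0 < s"
  defines "u \<equiv> s powr (1 / p)" and "v \<equiv> s powr (1 / q)"
  shows "cmod (of_real u * a) powr p = s * cmod a powr p"
    and "cmod (of_real v * b) powr q = s * cmod b powr q"
    and "young_deficit (of_real u * a) (of_real v * b) = s * young_deficit a b"
    and "dual_point p (of_real u * a) = of_real v * dual_point p a"
proof -
  have uv: "0 < u" "0 < v" using s by (auto simp: u_def v_def)
  show 1: "cmod (of_real u * a) powr p = s * cmod a powr p"
    using s uv p_gt_1 by (simp add: norm_mult powr_mult) (simp add: u_def powr_powr)
  show 2: "cmod (of_real v * b) powr q = s * cmod b powr q"
    using s uv q_gt_1 by (simp add: norm_mult powr_mult) (simp add: v_def powr_powr)
  have "u * v = s powr (1 / p + 1 / q)" by (simp add: u_def v_def powr_add)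
  then have "u * v = s" using s conjugate by simp
  then have "of_real u * a * cnj (of_real v * b) = of_real s * (a * cnj b)"
    by auto
  then have 3: "Re (of_real u * a * cnj (of_real v * b)) = s * Re (a * cnj b)"
    by (simp only: times_complex.sel Re_complex_of_real Im_complex_of_real mult_zero_left diff_zero)
  then show "young_deficit (of_real u * a) (of_real v * b) = s * young_deficit a b"
    unfolding young_deficit_def 1 2 3 by (simp only: right_diff_distrib distrib_left times_divide_eq_right)
  have "u * u powr (p - 2) = u powr 1 * u powr (p - 2)" using uv by simp
  also have "\<dots> = u powr (p - 1)" unfolding powr_add[symmetric] by simp
  also have "\<dots> = v"
  proof -
    have "1 / p * (p - 1) = 1 / q" using conjugate p_gt_1 by (simp add: field_simps)
    then show ?thesis by (simp only: u_def v_def powr_powr)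
  qed
  finally have uv': "v = u * u powr (p - 2)" ..
  show "dual_point p (of_real u * a) = of_real v * dual_point p a"
    unfolding uv' dual_point_def using uv by (simp add: norm_mult powr_mult)
qed

text \<open>
  By homogeneity it suffices to consider \<open>\<bar>a\<bar>\<^sup>p + \<bar>b\<bar>\<^sup>q = 1\<close>. The points of this compact set at which
  \<open>b\<close> is far from the dual point of \<open>a\<close> form a compact set \<open>K\<close> on which the deficit is positive,
  hence bounded below, while the left-hand side is bounded above. Outside \<open>K\<close> the term with \<open>\<eta>\<close>
  suffices.
\<close>

lemma young_deficit_stability:
  assumes \<eta>: "0 < \<eta>"
  obtains C where "0 \<le> C"
    "\<And>a b. cmod (b - dual_point p a) powr q \<le> \<eta> * (cmod a powr p + cmod b powr q) + C * young_deficit a b"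
proof -
  define K where "K = {z. cmod (fst z) powr p + cmod (snd z) powr q = 1 \<and>
    \<eta> \<le> cmod (snd z - dual_point p (fst z)) powr q}"
  have bound: "cmod a \<le> 1 \<and> cmod b \<le> 1" if "cmod a powr p + cmod b powr q = 1" for a b
  proof -
    have "cmod a powr p \<le> 1 powr p" "cmod b powr q \<le> 1 powr q"
      using that powr_ge_zero[of "cmod a" p] powr_ge_zero[of "cmod b" q] unfolding powr_one_eq_one by linarith+
    then show ?thesis
      using p_gt_1 q_gt_1 by (meson less_trans not_le norm_ge_zero powr_less_mono2 zero_le_one zero_less_one)
  qed
  have cont1: "continuous_on UNIV (\<lambda>z::complex\<times>complex. cmod (fst z) powr p + cmod (snd z) powr q)"
    using p_gt_1 q_gt_1 by (intro continuous_intros continuous_on_powr') auto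
  have "continuous_on UNIV (\<lambda>z::complex\<times>complex. dual_point p (fst z))"
    using p_gt_1 by (intro continuous_on_compose2[OF continuous_dual_point]) (auto intro!: continuous_intros)
  then have cont2: "continuous_on UNIV (\<lambda>z. cmod (snd z - dual_point p (fst z)) powr q)"
    using q_gt_1 by (intro continuous_intros continuous_on_powr') auto
  have "compact K"
  proof -
    have "closed K"
      unfolding K_def using cont1 cont2
      by (intro closed_Collect_conj closed_Collect_eq closed_Collect_le continuous_on_const) auto
    moreover have "K \<subseteq> cball 0 1 \<times> cball 0 1" using bound by (auto simp: K_def)
    then have "bounded K" by (rule bounded_subset[rotated]) (intro bounded_Times bounded_cball)
    ultimately show ?thesis by (simp add: compact_eq_bounded_closed)
  qed
  have pos: "0 < young_deficit (fst z) (snd z)" if "z \<in> K" for z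
  proof -
    have "young_deficit (fst z) (snd z) \<noteq> 0"
      using young_deficit_eq_0_imp[of "fst z" "snd z"] that \<eta> q_gt_1 by (auto simp: K_def)
    then show ?thesis using young_deficit_nonneg[of "fst z" "snd z"] by simp
  qed
  obtain \<delta> where \<delta>: "0 < \<delta>" "\<And>z. z \<in> K \<Longrightarrow> \<delta> \<le> young_deficit (fst z) (snd z)"
  proof (cases "K = {}")
    case False
    obtain z0 where "z0 \<in> K" "\<And>z. z \<in> K \<Longrightarrow> young_deficit (fst z0) (snd z0) \<le> young_deficit (fst z) (snd z)"
      using continuous_attains_inf[OF \<open>compact K\<close> False
          continuous_on_subset[OF continuous_young_deficit subset_UNIV]] by blast
    then show ?thesis using that pos by blast
  qed (use that[of 1] in auto)
  \<comment> \<open>On the unit set both \<open>b\<close> and the dual point of \<open>a\<close> have modulus at most \<open>1\<close>.\<close>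
  define C where "C = 2 powr q / \<delta>"
  have C0: "0 \<le> C" using \<delta> by (simp add: C_def)
  have unit: "cmod (b - dual_point p a) powr q \<le> \<eta> + C * young_deficit a b"
    if ab: "cmod a powr p + cmod b powr q = 1" for a b
  proof (cases "(a, b) \<in> K")
    case False
    then have "cmod (b - dual_point p a) powr q \<le> \<eta>" using ab by (auto simp: K_def)
    then show ?thesis using C0 young_deficit_nonneg[of a b] by (meson add_increasing2 mult_nonneg_nonneg)
  next
    case True
    have "cmod (dual_point p a) = cmod a powr (p - 1)" by (rule norm_dual_point)
    also have "\<dots> \<le> 1" using bound[OF ab] p_gt_1 by (intro powr_le1) auto
    finally have "cmod (b - dual_point p a) \<le> 2"
      using bound[OF ab] norm_triangle_ineq4[of b "dual_point p a"] by linarith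
    then have "cmod (b - dual_point p a) powr q \<le> 2 powr q" using q_gt_1 by (intro powr_mono2) auto
    also have "\<dots> = C * \<delta>" using \<delta> by (simp add: C_def)
    also have "\<dots> \<le> C * young_deficit a b" using \<delta>(2)[OF True] C0 by (intro mult_left_mono) auto
    finally show ?thesis using \<eta> by simp
  qed
  show ?thesis
  proof (rule that[OF C0])
    fix a b
    define s where "s = cmod a powr p + cmod b powr q"
    show "cmod (b - dual_point p a) powr q \<le> \<eta> * (cmod a powr p + cmod b powr q) + C * young_deficit a b"
    proof (cases "s = 0")
      case True
      have "a = 0" "b = 0"
        using True powr_ge_zero[of "cmod a" p] powr_ge_zero[of "cmod b" q] by (auto simp: s_def add_nonneg_eq_0_iff)
      then show ?thesis using p_gt_1 q_gt_1 by (simp add: dual_point_def young_deficit_def)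
    next
      case False
      then have s: "0 < s" using powr_ge_zero[of "cmod a" p] powr_ge_zero[of "cmod b" q] by (simp add: s_def less_le)
      define u where "u = s powr (1 / p)"
      define v where "v = s powr (1 / q)"
      define a' where "a' = a / of_real u"
      define b' where "b' = b / of_real v"
      have uv: "0 < u" "0 < v" using s by (auto simp: u_def v_def)
      have a: "a = of_real u * a'" and b: "b = of_real v * b'" using uv by (auto simp: a'_def b'_def)
      note hom = young_scaling[OF s, folded u_def v_def]
      have "s * (cmod a' powr p + cmod b' powr q) = cmod (of_real u * a') powr p + cmod (of_real v * b') powr q"
        unfolding hom(1,2) distrib_left ..
      also have "\<dots> = s" unfolding a[symmetric] b[symmetric] s_def ..
      finally have "cmod a' powr p + cmod b' powr q = 1" using s by simp
      from mult_left_mono[OF unit[OF this], of s] s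
      have "s * cmod (b' - dual_point p a') powr q \<le> \<eta> * s + C * (s * young_deficit a' b')"
        by (simp add: algebra_simps)
      moreover have "b - dual_point p a = of_real v * (b' - dual_point p a')"
        unfolding a b hom(4) right_diff_distrib ..
      ultimately show ?thesis
        using hom(2)[of "b' - dual_point p a'"] hom(3)[of a' b'] a b by (simp add: s_def)
    qed
  qed
qed

text \<open>
  If \<open>Y n\<close> almost norms \<open>X n\<close>, it is close to the norming functional. This is usually obtained from
  the uniform convexity of \<open>\<ell>\<^sub>q\<close>. Here it follows by summing the scalar stability estimate over the
  coordinates: the sum of the deficits tends to \<open>0\<close>, and the other term is small with \<open>\<eta>\<close>.
\<close>

lemma duality_map_stability:
  assumes X: "\<And>n. X n \<in> lp p" "\<And>n. lp_norm p (X n) = 1"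
    and Y: "\<And>n. Y n \<in> lp q" "\<And>n. pairing (X n) (Y n) = 1" and lim: "(\<lambda>n. lp_norm q (Y n)) \<longlonglongrightarrow> 1"
  shows "(\<lambda>n. lp_norm q (Y n - duality_map p (X n))) \<longlonglongrightarrow> 0"
proof (rule order_tendstoI)
  fix e :: real assume "e < 0"
  then show "\<forall>\<^sub>F n in sequentially. e < lp_norm q (Y n - duality_map p (X n))"
    by (intro always_eventually allI) (meson less_le_trans lp_norm_nonneg)
next
  fix e :: real assume e: "0 < e"
  \<comment> \<open>In the limit the two terms with the factor \<open>\<eta>\<close> contribute \<open>2 \<eta>\<close>, which must stay below \<open>e\<^sup>q\<close>.\<close>
  define \<eta> where "\<eta> = e powr q / 3"
  have \<eta>: "0 < \<eta>" using e by (simp add: \<eta>_def)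
  obtain C where C: "0 \<le> C" "\<And>a b. cmod (b - dual_point p a) powr q \<le>
      \<eta> * (cmod a powr p + cmod b powr q) + C * young_deficit a b"
    using young_deficit_stability[OF \<eta>] by blast
  define R where "R t = \<eta> * (1 + t powr q) + C * (1 / p + t powr q / q - 1)" for t
  have "(\<lambda>n. R (lp_norm q (Y n))) \<longlonglongrightarrow> \<eta> * (1 + 1 powr q) + C * (1 / p + 1 powr q / q - 1)"
    unfolding R_def using q_gt_1 by (intro tendsto_intros lim) auto
  then have limR: "(\<lambda>n. R (lp_norm q (Y n))) \<longlonglongrightarrow> 2 * \<eta>" using conjugate by (simp add: mult.commute)
  have "2 * \<eta> < e powr q" using e by (simp add: \<eta>_def)
  from order_tendstoD(2)[OF limR this]
  show "\<forall>\<^sub>F n in sequentially. lp_norm q (Y n - duality_map p (X n)) < e"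
  proof eventually_elim
    case (elim n)
    let ?J = "duality_map p (X n)"
    have d: "Y n - ?J \<in> lp q"
      using X Y q_gt_1 by (intro lp_diff duality_map_in_lp) auto
    have sX: "(\<lambda>j. cmod (X n j) powr p) sums 1"
      using lp_norm_powr[of p "X n"] X p_gt_1 by (simp add: lp_def sums_iff)
    have sY: "(\<lambda>j. cmod (Y n j) powr q) sums (lp_norm q (Y n) powr q)"
      using lp_norm_powr[of q "Y n"] Y q_gt_1 by (simp add: lp_def sums_iff)
    have "(\<lambda>j. X n j * cnj (Y n j)) sums 1"
      using summable_pairing[OF X(1) Y(1), of n n] Y(2)[of n] by (simp add: pairing_def sums_iff)
    then have sRe: "(\<lambda>j. Re (X n j * cnj (Y n j))) sums 1"
      using sums_Re by fastforce
    have sums: "(\<lambda>j. \<eta> * (cmod (X n j) powr p + cmod (Y n j) powr q) +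
        C * young_deficit (X n j) (Y n j)) sums R (lp_norm q (Y n))"
      unfolding R_def young_deficit_def
      by (intro sums_add sums_mult sums_diff sums_divide sX sY sRe)
    have "lp_norm q (Y n - ?J) powr q = (\<Sum>j. cmod ((Y n - ?J) j) powr q)"
      using d q_gt_1 by (intro lp_norm_powr) auto
    also have "\<dots> \<le> R (lp_norm q (Y n))"
      unfolding sums_unique[OF sums]
      using d sums_summable[OF sums] C(2)
      by (intro suminf_le) (auto simp: lp_def duality_map_eq_dual_point)
    also have "\<dots> < e powr q" by (rule elim)
    finally show ?case
      using e q_gt_1 by (meson lp_norm_nonneg less_imp_le less_trans not_le powr_mono2 zero_less_one)
  qed
qed

section \<open>Recovering the essential numerical range\<close>

text \<open>
  The condition is applied to the subspace \<open>M n\<close> of sequences whose first \<open>n\<close> coordinates vanish,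
  with \<open>F = {0}\<close>. Unit vectors in \<open>M n\<close> are weakly null as \<open>n\<close> grows, and the functionals \<open>Y n\<close> may be
  replaced by the dual vectors of the \<open>X n\<close>.
\<close>

lemma approximation_imp_essential_numerical_range:
  assumes T: "bounded_operator p T"
    and approx: "\<And>M F \<epsilon>. finite_codim_subspace p M \<Longrightarrow> finite_dim_subspace p F \<Longrightarrow> 0 < \<epsilon> \<Longrightarrow>
      \<exists>x xs. x \<in> M \<and> xs \<in> annihilator q F \<and> lp_norm p x = 1 \<and> pairing x xs = 1 \<and>
        lp_norm q xs < 1 + \<epsilon> \<and> cmod (pairing (T x) xs - \<mu>) < \<epsilon>"
  shows "\<mu> \<in> essential_numerical_range p q T"
proof -
  define F where "F n = cseq.span (unit_seq ` {..<n})" for n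
  define M where "M n = annihilator p (F n)" for n
  have M: "finite_codim_subspace p (M n)" for n
    unfolding M_def F_def
    by (intro finite_codim_annihilator) (auto simp: finite_dim_subspace_def unit_seq_in_lp intro!: exI[of _ "unit_seq ` {..<n}"])
  have triv: "finite_dim_subspace p {0}"
    unfolding finite_dim_subspace_def by (intro exI[of _ "{}"]) simp
  have "\<exists>x xs. x \<in> M n \<and> xs \<in> lp q \<and> lp_norm p x = 1 \<and> pairing x xs = 1 \<and>
      lp_norm q xs < 1 + 1 / Suc n \<and> cmod (pairing (T x) xs - \<mu>) < 1 / Suc n" for n
    using approx[OF M[of n] triv, of "1 / Suc n"] by (auto simp: annihilator_def)
  then obtain X Y where XM: "\<And>n. X n \<in> M n" and Y: "\<And>n. Y n \<in> lp q"
    and X1: "\<And>n. lp_norm p (X n) = 1" and XY: "\<And>n. pairing (X n) (Y n) = 1"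
    and Y1: "\<And>n. lp_norm q (Y n) < 1 + 1 / Suc n"
    and TX: "\<And>n. cmod (pairing (T (X n)) (Y n) - \<mu>) < 1 / Suc n"
    by metis
  have X: "X n \<in> lp p" for n using XM[of n] by (simp add: M_def annihilator_def)
  have inv: "(\<lambda>n. 1 / real (Suc n)) \<longlonglongrightarrow> 0" by (rule LIMSEQ_Suc[OF lim_1_over_n])
  have zero: "X n j = 0" if "j < n" for n j
  proof -
    have "pairing (unit_seq j) (X n) = 0"
      using XM[of n] that by (auto simp: M_def F_def annihilator_def intro: cseq.span_base)
    then show ?thesis
      using pairing_commute[OF X[of n] unit_seq_in_lp[of j]] by (simp add: pairing_unit_seq_right)
  qed
  have null: "weakly_null q X"
  proof (rule weakly_null_of_bounded_coordinatewise[where K = 1])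
    show "(\<lambda>n. X n j) \<longlonglongrightarrow> 0" for j
      by (rule tendsto_eventually) (use zero in \<open>auto simp: eventually_sequentially intro!: exI[of _ "Suc j"]\<close>)
  qed (simp_all add: X X1)
  have limY: "(\<lambda>n. lp_norm q (Y n)) \<longlonglongrightarrow> 1"
  proof (rule tendsto_sandwich)
    have "1 \<le> lp_norm q (Y n)" for n using norm_pairing_le[OF X Y, of n n] XY X1 by simp
    then show "\<forall>\<^sub>F n in sequentially. 1 \<le> lp_norm q (Y n)" by simp
    show "\<forall>\<^sub>F n in sequentially. lp_norm q (Y n) \<le> 1 + 1 / Suc n"
      using less_imp_le[OF Y1] by simp
    show "(\<lambda>n. 1 + 1 / real (Suc n)) \<longlonglongrightarrow> 1" using tendsto_add[OF tendsto_const inv, of 1] by simp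
  qed simp
  have J: "duality_map p (X n) \<in> lp q" "lp_norm q (duality_map p (X n)) = 1" for n
    by (rule duality_map_in_lp[OF X]) (simp add: duality_map_lp_norm[OF X] X1)
  have limJ: "(\<lambda>n. lp_norm q (Y n - duality_map p (X n))) \<longlonglongrightarrow> 0"
    by (rule duality_map_stability[OF X X1 Y XY limY])
  obtain K where K: "0 \<le> K" "\<And>x. x \<in> lp p \<Longrightarrow> lp_norm p (T x) \<le> K * lp_norm p x"
    using bounded_operatorE[OF T] by blast
  have Tlp: "T (X n) \<in> lp p" for n using T X by (rule bounded_operator_in_lp)
  have "(\<lambda>n. pairing (T (X n)) (Y n) - pairing (T (X n)) (duality_map p (X n))) \<longlonglongrightarrow> 0"
  proof (rule pairing_difference_tendsto_0[OF Tlp Tlp Y J(1) _ _ _ limJ, where K = "max K 1"])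
    show "lp_norm p (T (X n)) \<le> max K 1" for n using K(2)[OF X, of n] X1 by simp
  qed (simp_all add: J lp_norm_zero)
  moreover have "(\<lambda>n. pairing (T (X n)) (Y n)) \<longlonglongrightarrow> \<mu>"
    by (rule LIM_zero_cancel, rule Lim_null_comparison[OF _ inv]) (use less_imp_le[OF TX] in simp)
  ultimately have "(\<lambda>n. pairing (T (X n)) (Y n) -
      (pairing (T (X n)) (Y n) - pairing (T (X n)) (duality_map p (X n)))) \<longlonglongrightarrow> \<mu> - 0"
    by (intro tendsto_diff)
  then have "(\<lambda>n. pairing (T (X n)) (duality_map p (X n))) \<longlonglongrightarrow> \<mu>" by simp
  then show ?thesis
    unfolding essential_numerical_range_def using X X1 null by blast
qed

end

theorem corollary3p5:
  fixes p q :: real and T :: "(nat \<Rightarrow> complex) \<Rightarrow> (nat \<Rightarrow> complex)" and \<mu> :: complex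
  assumes "1 < p" and "1 / p + 1 / q = 1" and "bounded_operator p T"
  shows "(\<mu> \<in> essential_numerical_range p q T \<longleftrightarrow>
      (\<forall>M F. \<forall>\<epsilon>>0. finite_codim_subspace p M \<and> finite_dim_subspace p F \<longrightarrow>
        (\<exists>x xs. x \<in> M \<and> xs \<in> annihilator q F \<and>
          lp_norm p x = 1 \<and> pairing x xs = 1 \<and> lp_norm q xs < 1 + \<epsilon> \<and>
          cmod (pairing (T x) xs - \<mu>) < \<epsilon>))) \<and>
    (\<mu> \<in> essential_numerical_range p q T \<longrightarrow>
      (\<forall>M F. \<forall>\<epsilon>>0. finite_codim_subspace p M \<and> finite_dim_subspace p F \<longrightarrow>
        (\<exists>x xs. x \<in> M \<and> finite {j. x j \<noteq> 0} \<and> xs \<in> annihilator q F \<and>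
          lp_norm p x = 1 \<and> pairing x xs = 1 \<and> lp_norm q xs < 1 + \<epsilon> \<and>
          cmod (pairing (T x) xs - \<mu>) < \<epsilon>)))"
proof -
  interpret conjugate_exponents p q using assms by unfold_locales
  note forward = essential_numerical_range_imp_approximation[OF assms(3)]
  show ?thesis
  proof (intro conjI iffI impI allI)
    fix M F and \<epsilon> :: real
    assume "\<mu> \<in> essential_numerical_range p q T" "0 < \<epsilon>"
      "finite_codim_subspace p M \<and> finite_dim_subspace p F"
    with forward show "\<exists>x xs. x \<in> M \<and> finite {j. x j \<noteq> 0} \<and> xs \<in> annihilator q F \<and>
          lp_norm p x = 1 \<and> pairing x xs = 1 \<and> lp_norm q xs < 1 + \<epsilon> \<and>
          cmod (pairing (T x) xs - \<mu>) < \<epsilon>" by blast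
    then show "\<exists>x xs. x \<in> M \<and> xs \<in> annihilator q F \<and>
          lp_norm p x = 1 \<and> pairing x xs = 1 \<and> lp_norm q xs < 1 + \<epsilon> \<and>
          cmod (pairing (T x) xs - \<mu>) < \<epsilon>" by blast
  qed (rule approximation_imp_essential_numerical_range[OF assms(3)], blast)
qed

end
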